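(* Assume conditions (M) and (CC). Suppose that $\emptyset\notin\Psi$, $\mathsf P\in\mathcal P_\Psi$, and let the isolation subsystems be selected such that $$\min_{e\in\mathcal A(\mathsf P)}\mathcal I(\mathsf P,\mathcal H_{\Psi,e};s'_e)=\min_{e\in\mathcal A(\mathsf P)}\mathcal I(\mathsf P,\mathcal H_{\Psi,e}),\qquad \min_{e\notin\mathcal A(\mathsf P)}\mathcal I(\mathsf P,\mathcal G_{\Psi,e};s'_e)=\min_{e\notin\mathcal A(\mathsf P)}\mathcal I(\mathsf P,\mathcal G_{\Psi,e})$$ (which is trivially the case when $s'_e=[K]$ for every $e\in\mathcal K$). Then, as $\gamma,\delta\to0$, $$\mathsf E_{\mathsf P}[T^*]\sim\max_{e\in\mathcal A(\mathsf P)}\Big\{\frac{|\log\gamma|}{\mathcal I(\mathsf P,\mathcal H_{\Psi,e})}\Big\}\bigvee\max_{e\notin\mathcal A(\mathsf P)}\Big\{\frac{|\log\delta|}{\mathcal I(\mathsf P,\mathcal G_{\Psi,e})}\Big\}\sim\inf\{\mathsf E_{\mathsf P}[T]:(T,D)\in\mathcal C_\Psi(\gamma,\delta)\}.$$ When, in particular, $\Psi=\Psi_{m,m}:=\{A\subseteq\mathcal K:|A|=m\}$ for some $m\in(0,|\mathcal K|)$, then, as $\gamma,\delta\to0$, $$\mathsf E_{\mathsf P}[T^*]\sim\frac{|\log(\gamma\wedge\delta)|}{\mathcal I(\mathsf P,\mathcal P_\Psi\setminus\{\mathsf P\})}\sim\inf\{\mathsf E_{\mathsf P}[T]:(T,D)\in\mathcal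 C_\Psi(\gamma,\delta)\}.$$
   Context: Setting. There are $K$ data sources, $[K]=\{1,\dots,K\}$; $X_n^k$ is the random element observed from source $k$ at time $n\in\mathbb N=\{1,2,\dots\}$. For $s\subseteq[K]$: $X_n^s=\{X_n^k:k\in s\}$, $X^s=\{X_n^s:n\in\mathbb N\}$, $\mathcal F_n^s=\sigma(X_1^s,\dots,X_n^s)$; the superscript is omitted when $s=[K]$. $\mathcal P$ is a finite family of distributions of $X$; $\mathsf P^s$ is the law of $X^s$ under $\mathsf P$, and $\mathcal Q^s=\{\mathsf P^s:\mathsf P\in\mathcal Q\}$. $\mathcal K$ is a finite family of subsets of $[K]$ (units). For each $e\in\mathcal K$, $\mathcal H^e$ and $\mathcal G^e$ are nonempty disjoint subfamilies of $\mathcal P^e$; $\mathcal A(\mathsf P)=\{e\in\mathcal K:\mathsf P^e\in\mathcal G^e\}$. $\Psi$ is a family of subsets of $\mathcal K$, and $\mathcal P_\Psi=\{\mathsf P\in\mathcal P:\mathsf P^e\in\mathcal H^e\cup\mathcal G^e\ \forall e\in\mathcal K,\ \mathcal A(\mathsf P)\in\Psi\}$, $\mathcal H_0=\{\mathsf P\in\mathcal P:\mathsf P^e\in\mathcal H^e\ \forall e\}$, $\mathcal H_{\Psi,e}=\{\mathsf P\in\mathcal P_\Psi\setminus\mathcal H_0:e\notin\mathcal A(\mathsf P)\}$, $\mathcal G_{\Psi,e}=\{\mathsf P\in\mathcal P_\Psi:e\in\mathcal A(\mathsf P)\}$. Standing assumption: for every $e\in\mathcal K$, $\mathsf P\in\mathcal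 G_{\Psi,e}\cup\mathcal H_0$, $\mathsf Q\in\mathcal H_{\Psi,e}\cup\mathcal H_0$, $e\subseteq s\subseteq[K]$, $n\in\mathbb N$, $\mathsf P^s,\mathsf Q^s$ are mutually absolutely continuous on $\mathcal F_n^s$; $\Lambda_n(\mathsf P^s,\mathsf Q^s)=\frac{d\mathsf P^s}{d\mathsf Q^s}(\mathcal F_n^s)$, $Z_n=\log\Lambda_n$. Conditions (M) and (CC): for every $e\in\mathcal K$, $\mathsf P\in\mathcal G_{\Psi,e}$, $\mathsf Q\in\mathcal H_{\Psi,e}\cup\mathcal H_0$, $e\subseteq s\subseteq[K]$ there are positive numbers $\mathcal I(\mathsf P^s,\mathsf Q^s)$, $\mathcal I(\mathsf Q^s,\mathsf P^s)$ such that: (M) as $n\to\infty$, $\mathsf P(\max_{1\le m\le n}Z_m(\mathsf P^s,\mathsf Q^s)\ge n\rho)\to0$ for all $\rho>\mathcal I(\mathsf P^s,\mathsf Q^s)$ and $\mathsf Q(\max_{1\le m\le n}Z_m(\mathsf Q^s,\mathsf P^s)\ge n\rho)\to0$ for all $\rho>\mathcal I(\mathsf Q^s,\mathsf P^s)$; (CC) $\sum_{n\ge1}\mathsf P(Z_n(\mathsf P^s,\mathsf Q^s)<n\rho)<\infty$ for all $\rho<\mathcal I(\mathsf P^s,\mathsf Q^s)$ and $\sum_{n\ge1}\mathsf Q(Z_n(\mathsf Q^s,\mathsf P^s)<n\rho)<\infty$ for all $\rho<\mathcal I(\mathsf Q^s,\mathsf P^s)$. Notation: $\mathcal I(\mathsf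 P,\mathsf Q;s)=\mathcal I(\mathsf P^s,\mathsf Q^s)$, $\mathcal I(\mathsf P,\mathcal Q;s)=\min_{\mathsf Q\in\mathcal Q}\mathcal I(\mathsf P,\mathsf Q;s)$ for $\mathcal Q\subseteq\mathcal P_\Psi$, whenever the quantities on the right-hand side are well defined; $s$ is omitted when $s=[K]$. Isolation statistics: each unit has an isolation subsystem $s'_e$, $e\subseteq s'_e\subseteq[K]$, and $\Lambda_{e,\rm iso}(n)=\dfrac{\max\{\Lambda_n(\mathsf P,\mathsf P_0'):\mathsf P\in\mathcal G_{\Psi,e}^{s'_e}\}}{\max\{\Lambda_n(\mathsf P,\mathsf P_0'):\mathsf P\in\mathcal H_{\Psi,e}^{s'_e}\}}$, $\mathsf P_0'\in\mathcal H_0^{s'_e}$ arbitrary (families over which maxima are taken are tacitly nonempty); $D_{\rm iso}(n)=\{e:\Lambda_{e,\rm iso}(n)>1\}$. $\mathcal C_\Psi(\gamma,\delta)$ is the class of tests $(T,D)$ ($T$ an $\{\mathcal F_n\}$-stopping time, $D$ $\mathcal F_T$-measurable and $\Psi$-valued) with $\mathsf P(D\setminus\mathcal A(\mathsf P)\neq\emptyset)\le\gamma$ and $\mathsf P(\mathcal A(\mathsf P)\setminus D\ne\emptyset,D\ne\emptyset)\le\delta$ for all $\mathsf P\in\mathcal P_\Psi$. Test ($\emptyset\notin\Psi$): $T^*=\inf\{n\in\mathbb N:D_{\rm iso}(n)\in\Psi,\ \Lambda_{e,\rm iso}(n)\notin(1/A_e,B_e)\ \forall e\in\mathcal K\}$,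 $D^*=D_{\rm iso}(T^* )$, $\chi^*=(T^*,D^* )$. The thresholds are functions of $\gamma,\delta\in(0,1)$ such that $\chi^*\in\mathcal C_\Psi(\gamma,\delta)$ for all $\gamma,\delta$, and $\log A_e\sim|\log\delta|$, $\log B_e\sim|\log\gamma|$ as $\gamma,\delta\to0$ for every $e$. $x\sim y$ means $x/y\to1$. Extrema over empty index sets are omitted. *)

theory Defs
  imports "HOL-Probability.Probability"
begin

section \<open>Setting\<close>

text \<open>
  A path of the data is a function of pairs (source, time); sources are \<open>1, \<dots>, K\<close> and times
  are \<open>1, 2, \<dots>\<close>. The sample space is the canonical one, so a distribution of the whole data
  \<open>X\<close> is a probability measure on the product over \<open>[K] \<times> \<nat>\<close>, and \<open>X\<^sup>s\<close> is the
  restriction of a path to \<open>s \<times> \<nat>\<close>. Each \<open>X\<^sub>n\<^sup>k\<close> may have its own measurable space of values.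
\<close>

type_synonym 'b path = "nat \<times> nat \<Rightarrow> 'b"

record 'b problem =
  num_sources :: nat
  obs :: "nat \<Rightarrow> nat \<Rightarrow> 'b measure"  \<comment> \<open>\<open>obs M k n\<close>: value space of source \<open>k\<close> at time \<open>n\<close>\<close>
  dists :: "'b path measure set"
  units :: "nat set set"
  null_laws :: "nat set \<Rightarrow> 'b path measure set"  \<comment> \<open>the families \<open>\<H>\<^sup>e\<close>\<close>
  alt_laws :: "nat set \<Rightarrow> 'b path measure set"  \<comment> \<open>the families \<open>\<G>\<^sup>e\<close>\<close>
  Psi :: "nat set set set"

definition all_sources :: "'b problem \<Rightarrow> nat set" where
  "all_sources M = {1..num_sources M}"

definition path_space :: "'b problem \<Rightarrow> nat set \<Rightarrow> 'b path measure" where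
  "path_space M s = PiM (s \<times> {1..}) (\<lambda>(k, n). obs M k n)"

definition subsystem :: "nat set \<Rightarrow> 'b path \<Rightarrow> 'b path" where
  "subsystem s \<omega> = restrict \<omega> (s \<times> {1..})"

definition law :: "'b problem \<Rightarrow> nat set \<Rightarrow> 'b path measure \<Rightarrow> 'b path measure" where
  "law M s P = distr P (path_space M s) (subsystem s)"

text \<open>\<open>\<F>\<^sub>n\<^sup>s\<close> as a sub-sigma-algebra of the path space of \<open>s\<close>.\<close>

definition history :: "'b problem \<Rightarrow> nat set \<Rightarrow> nat \<Rightarrow> 'b path measure" where
  "history M s n =
     vimage_algebra (space (path_space M s)) (\<lambda>x. restrict x (s \<times> {1..n}))
       (PiM (s \<times> {1..n}) (\<lambda>(k, i). obs M k i))"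

definition active :: "'b problem \<Rightarrow> 'b path measure \<Rightarrow> nat set set" where
  "active M P = {e \<in> units M. law M e P \<in> alt_laws M e}"

definition P_Psi :: "'b problem \<Rightarrow> 'b path measure set" where
  "P_Psi M = {P \<in> dists M.
     (\<forall>e\<in>units M. law M e P \<in> null_laws M e \<union> alt_laws M e) \<and> active M P \<in> Psi M}"

definition H_zero :: "'b problem \<Rightarrow> 'b path measure set" where
  "H_zero M = {P \<in> dists M. \<forall>e\<in>units M. law M e P \<in> null_laws M e}"

definition H_Psi :: "'b problem \<Rightarrow> nat set \<Rightarrow> 'b path measure set" where
  "H_Psi M e = {P \<in> P_Psi M - H_zero M. e \<notin> active M P}"

definition G_Psi :: "'b problem \<Rightarrow> nat set \<Rightarrow> 'b path measure set" where
  "G_Psi M e = {P \<in> P_Psi M. e \<in> active M P}"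

definition valid_problem :: "'b problem \<Rightarrow> bool" where
  "valid_problem M \<longleftrightarrow>
     finite (dists M) \<and>
     (\<forall>P\<in>dists M. prob_space P \<and> sets P = sets (path_space M (all_sources M))) \<and>
     units M \<subseteq> Pow (all_sources M) \<and>
     (\<forall>e\<in>units M.
        null_laws M e \<noteq> {} \<and> null_laws M e \<subseteq> law M e ` dists M \<and>
        alt_laws M e \<noteq> {} \<and> alt_laws M e \<subseteq> law M e ` dists M \<and>
        null_laws M e \<inter> alt_laws M e = {}) \<and>
     Psi M \<subseteq> Pow (units M)"

section \<open>Likelihood ratios and information numbers\<close>

definition mutually_ac :: "'b path measure \<Rightarrow> 'b path measure \<Rightarrow> 'b path measure \<Rightarrow> bool" where
  "mutually_ac F \<mu> \<nu> \<longleftrightarrow>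
     absolutely_continuous (restr_to_subalg \<mu> F) (restr_to_subalg \<nu> F) \<and>
     absolutely_continuous (restr_to_subalg \<nu> F) (restr_to_subalg \<mu> F)"

definition standing_ac :: "'b problem \<Rightarrow> bool" where
  "standing_ac M \<longleftrightarrow>
     (\<forall>e\<in>units M. \<forall>P\<in>G_Psi M e \<union> H_zero M. \<forall>Q\<in>H_Psi M e \<union> H_zero M.
        \<forall>s n. e \<subseteq> s \<and> s \<subseteq> all_sources M \<and> 1 \<le> n \<longrightarrow>
          mutually_ac (history M s n) (law M s P) (law M s Q))"

text \<open>
  The density of \<open>\<mu>\<close> with respect to \<open>\<nu>\<close> on \<open>\<F>\<^sub>n\<^sup>s\<close>, where \<open>\<mu>\<close> and \<open>\<nu>\<close> are laws of \<open>X\<^sup>s\<close>.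
  As \<^const>\<open>RN_deriv\<close> is an unspecified version of the density, statements about it are about any version.
  The conversion to a real number changes only the value infinity, which the density takes
  with probability zero.
\<close>

definition LR :: "'b problem \<Rightarrow> nat set \<Rightarrow> nat \<Rightarrow> 'b path measure \<Rightarrow> 'b path measure \<Rightarrow> 'b path \<Rightarrow> real" where
  "LR M s n \<mu> \<nu> x =
     enn2real (RN_deriv (restr_to_subalg \<nu> (history M s n)) (restr_to_subalg \<mu> (history M s n)) x)"

text \<open>\<open>Z\<^sub>n(P\<^sup>s, Q\<^sup>s)\<close> as a random variable on the full sample space.\<close>

definition LLR ::
  "'b problem \<Rightarrow> nat set \<Rightarrow> nat \<Rightarrow> 'b path measure \<Rightarrow> 'b path measure \<Rightarrow> 'b path \<Rightarrow> real" where
  "LLR M s n P Q \<omega> = ln (LR M s n (law M s P) (law M s Q) (subsystem s \<omega>))"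

text \<open>The triples \<open>(s, P, Q)\<close> to which conditions (M) and (CC) refer.\<close>

definition comparable :: "'b problem \<Rightarrow> nat set \<Rightarrow> 'b path measure \<Rightarrow> 'b path measure \<Rightarrow> bool" where
  "comparable M s P Q \<longleftrightarrow>
     (\<exists>e\<in>units M. P \<in> G_Psi M e \<and> Q \<in> H_Psi M e \<union> H_zero M \<and> e \<subseteq> s \<and> s \<subseteq> all_sources M)"

text \<open>In what follows \<open>I \<mu> \<nu>\<close> is the number attached to the pair of laws \<open>(\<mu>, \<nu>)\<close>.\<close>

type_synonym 'b info = "'b path measure \<Rightarrow> 'b path measure \<Rightarrow> real"

definition positive_info :: "'b problem \<Rightarrow> 'b info \<Rightarrow> bool" where
  "positive_info M I \<longleftrightarrow>
     (\<forall>s P Q. comparable M s P Q \<longrightarrow>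
        0 < I (law M s P) (law M s Q) \<and> 0 < I (law M s Q) (law M s P))"

definition max_growth ::
  "'b problem \<Rightarrow> 'b info \<Rightarrow> nat set \<Rightarrow> 'b path measure \<Rightarrow> 'b path measure \<Rightarrow> bool" where
  "max_growth M I s P Q \<longleftrightarrow>
     (\<forall>\<rho> > I (law M s P) (law M s Q).
        (\<lambda>n. measure P {\<omega> \<in> space P. Max ((\<lambda>m. LLR M s m P Q \<omega>) ` {1..n}) \<ge> real n * \<rho>})
          \<longlonglongrightarrow> 0)"

definition complete_growth ::
  "'b problem \<Rightarrow> 'b info \<Rightarrow> nat set \<Rightarrow> 'b path measure \<Rightarrow> 'b path measure \<Rightarrow> bool" where
  "complete_growth M I s P Q \<longleftrightarrow>
     (\<forall>\<rho> < I (law M s P) (law M s Q).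
        summable (\<lambda>n. measure P {\<omega> \<in> space P. LLR M s (Suc n) P Q \<omega> < real (Suc n) * \<rho>}))"

definition condition_M :: "'b problem \<Rightarrow> 'b info \<Rightarrow> bool" where
  "condition_M M I \<longleftrightarrow>
     (\<forall>s P Q. comparable M s P Q \<longrightarrow> max_growth M I s P Q \<and> max_growth M I s Q P)"

definition condition_CC :: "'b problem \<Rightarrow> 'b info \<Rightarrow> bool" where
  "condition_CC M I \<longleftrightarrow>
     (\<forall>s P Q. comparable M s P Q \<longrightarrow> complete_growth M I s P Q \<and> complete_growth M I s Q P)"

text \<open>
  \<open>\<I>(P, \<Q>; s)\<close>. The conditions provide \<open>\<I>(P, Q; s)\<close> only for comparable \<open>P\<close> and \<open>Q\<close> (in either
  order), and the minimum runs over those \<open>Q\<close> in \<open>\<Q>\<close>. For \<open>\<Q> = \<H>\<^bsub>\<Psi>,e\<^esub>\<close> with \<open>e \<in> \<A>(P)\<close>, and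
  for \<open>\<Q> = \<G>\<^bsub>\<Psi>,e\<^esub>\<close> with \<open>e \<notin> \<A>(P)\<close>, this is all of \<open>\<Q>\<close>. For \<open>\<Q> = \<P>\<^sub>\<Psi> - {P}\<close> it leaves out
  the \<open>Q\<close> with \<open>\<A>(Q) = \<A>(P)\<close>, for which no number \<open>\<I>(P, Q)\<close> is given.
\<close>

definition info_min ::
  "'b problem \<Rightarrow> 'b info \<Rightarrow> nat set \<Rightarrow> 'b path measure \<Rightarrow> 'b path measure set \<Rightarrow> real" where
  "info_min M I s P \<Q> =
     Min {I (law M s P) (law M s Q) |Q. Q \<in> \<Q> \<and> (comparable M s P Q \<or> comparable M s Q P)}"

section \<open>Sequential tests\<close>

text \<open>The filtration of all sources, extended by the full sigma-algebra at infinity.\<close>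

definition filt :: "'b problem \<Rightarrow> enat \<Rightarrow> 'b path measure" where
  "filt M t = (case t of enat n \<Rightarrow> history M (all_sources M) n | \<infinity> \<Rightarrow> path_space M (all_sources M))"

type_synonym 'b test = "('b path \<Rightarrow> enat) \<times> ('b path \<Rightarrow> nat set set)"

definition tests :: "'b problem \<Rightarrow> real \<Rightarrow> real \<Rightarrow> 'b test set" where
  "tests M \<gamma> \<delta> = {(T, D).
     stopping_time (filt M) T \<and>
     (\<forall>\<omega>\<in>space (path_space M (all_sources M)). 1 \<le> T \<omega>) \<and>
     D \<in> measurable (filtration.pre_sigma (space (path_space M (all_sources M))) (filt M) T)
                    (count_space (Psi M)) \<and>
     (\<forall>P\<in>P_Psi M.
        measure P {\<omega> \<in> space P. D \<omega> - active M P \<noteq> {}} \<le> \<gamma> \<and>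
        measure P {\<omega> \<in> space P. active M P - D \<omega> \<noteq> {} \<and> D \<omega> \<noteq> {}} \<le> \<delta>)}"

definition expected_time :: "'b path measure \<Rightarrow> ('b path \<Rightarrow> enat) \<Rightarrow> ennreal" where
  "expected_time P T = (\<integral>\<^sup>+ \<omega>. ennreal_of_enat (T \<omega>) \<partial>P)"

text \<open>
  Isolation statistics: \<open>s' e\<close> is the isolation subsystem of unit \<open>e\<close> and \<open>P0 e\<close> the reference
  law of \<open>X\<close> on it.
\<close>

definition iso_stat ::
  "'b problem \<Rightarrow> (nat set \<Rightarrow> nat set) \<Rightarrow> (nat set \<Rightarrow> 'b path measure) \<Rightarrow> nat set \<Rightarrow> nat \<Rightarrow> 'b path \<Rightarrow> real" where
  "iso_stat M s' P0 e n \<omega> =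
     Max ((\<lambda>\<mu>. LR M (s' e) n \<mu> (P0 e) (subsystem (s' e) \<omega>)) ` law M (s' e) ` G_Psi M e) /
     Max ((\<lambda>\<mu>. LR M (s' e) n \<mu> (P0 e) (subsystem (s' e) \<omega>)) ` law M (s' e) ` H_Psi M e)"

definition D_iso ::
  "'b problem \<Rightarrow> (nat set \<Rightarrow> nat set) \<Rightarrow> (nat set \<Rightarrow> 'b path measure) \<Rightarrow> nat \<Rightarrow> 'b path \<Rightarrow> nat set set" where
  "D_iso M s' P0 n \<omega> = {e \<in> units M. iso_stat M s' P0 e n \<omega> > 1}"

definition T_star ::
  "'b problem \<Rightarrow> (nat set \<Rightarrow> nat set) \<Rightarrow> (nat set \<Rightarrow> 'b path measure) \<Rightarrow>
   (nat set \<Rightarrow> real) \<Rightarrow> (nat set \<Rightarrow> real) \<Rightarrow> 'b path \<Rightarrow> enat" where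
  "T_star M s' P0 A B \<omega> =
     Inf {enat n |n. 1 \<le> n \<and> D_iso M s' P0 n \<omega> \<in> Psi M \<and>
                     (\<forall>e\<in>units M. iso_stat M s' P0 e n \<omega> \<notin> {1 / A e <..< B e})}"

text \<open>If \<open>T_star\<close> is infinite no decision is prescribed; the value there is an unspecified
  member of \<open>\<Psi>\<close>.\<close>

definition D_star ::
  "'b problem \<Rightarrow> (nat set \<Rightarrow> nat set) \<Rightarrow> (nat set \<Rightarrow> 'b path measure) \<Rightarrow>
   (nat set \<Rightarrow> real) \<Rightarrow> (nat set \<Rightarrow> real) \<Rightarrow> 'b path \<Rightarrow> nat set set" where
  "D_star M s' P0 A B \<omega> =
     (case T_star M s' P0 A B \<omega> of enat n \<Rightarrow> D_iso M s' P0 n \<omega> | \<infinity> \<Rightarrow> (SOME d. d \<in> Psi M))"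

section \<open>Asymptotics\<close>

text \<open>The limit \<open>\<gamma>, \<delta> \<rightarrow> 0\<close> is joint, with no relation between the rates.\<close>

definition errors_to_0 :: "(real \<times> real) filter" where
  "errors_to_0 = at_right 0 \<times>\<^sub>F at_right 0"

definition sim ::
  "(real \<Rightarrow> real \<Rightarrow> 'r::{inverse, one, topological_space}) \<Rightarrow> (real \<Rightarrow> real \<Rightarrow> 'r) \<Rightarrow> bool" where
  "sim f g \<longleftrightarrow> ((\<lambda>(\<gamma>, \<delta>). f \<gamma> \<delta> / g \<gamma> \<delta>) \<longlongrightarrow> 1) errors_to_0"

text \<open>
  The two maxima are taken jointly, as the maximum of one set, so that a maximum over an empty
  index set drops out.
\<close>

definition time_bound :: "'b problem \<Rightarrow> 'b info \<Rightarrow> 'b path measure \<Rightarrow> real \<Rightarrow> real \<Rightarrow> real" where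
  "time_bound M I P \<gamma> \<delta> =
     Max ((\<lambda>e. \<bar>ln \<gamma>\<bar> / info_min M I (all_sources M) P (H_Psi M e)) ` active M P \<union>
          (\<lambda>e. \<bar>ln \<delta>\<bar> / info_min M I (all_sources M) P (G_Psi M e)) ` (units M - active M P))"

definition optimal_time :: "'b problem \<Rightarrow> 'b path measure \<Rightarrow> real \<Rightarrow> real \<Rightarrow> ennreal" where
  "optimal_time M P \<gamma> \<delta> = (INF (T, D) \<in> tests M \<gamma> \<delta>. expected_time P T)"

text \<open>
  The condition on the isolation subsystems. If every unit is active, the second equation
  holds trivially, as both sides are the minimum of the same (empty) set.
\<close>

definition isolation_selected ::
  "'b problem \<Rightarrow> 'b info \<Rightarrow> (nat set \<Rightarrow> nat set) \<Rightarrow> 'b path measure \<Rightarrow> bool" where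
  "isolation_selected M I s' P \<longleftrightarrow>
     Min ((\<lambda>e. info_min M I (s' e) P (H_Psi M e)) ` active M P) =
       Min ((\<lambda>e. info_min M I (all_sources M) P (H_Psi M e)) ` active M P) \<and>
     Min ((\<lambda>e. info_min M I (s' e) P (G_Psi M e)) ` (units M - active M P)) =
       Min ((\<lambda>e. info_min M I (all_sources M) P (G_Psi M e)) ` (units M - active M P))"

lemma isolation_selected_all_sources:
  assumes "\<forall>e\<in>units M. s' e = all_sources M"
  shows "isolation_selected M I s' P"
  using assms unfolding isolation_selected_def
  by (intro conjI arg_cong[where f = Min] image_cong) (auto simp: active_def)

end

theory Submission
  imports Defs
begin

text \<open>
  Fix the true law \<open>P\<close>. For each unit \<open>e\<close>, call a law in \<open>\<P>\<^sub>\<Psi>\<close> a rival of \<open>P\<close> at \<open>e\<close> if it disagrees with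
  \<open>P\<close> about whether \<open>e\<close> is active. Deciding correctly about \<open>e\<close> under \<open>P\<close> means committing an error under
  every rival, an error whose probability may be at most \<open>\<gamma>\<close> if \<open>e\<close> is active and \<open>\<delta>\<close> if it is not. The
  evidence against a rival \<open>Q\<close> is the log-likelihood ratio \<open>Z\<^sub>n(P, Q)\<close>, which grows under \<open>P\<close> at rate
  \<open>\<I>(P, Q)\<close>. So the time needed is \<open>\<bar>ln \<gamma>\<bar>\<close> or \<open>\<bar>ln \<delta>\<bar>\<close> divided by the rate of the hardest rival, and
  the unit for which this is largest determines the total: this is \<open>time_bound\<close>.

  No test is faster. A change of measure at the stopping time (\<open>change_of_measure_at_stopping\<close>) shows
  that stopping by time \<open>n\<close> with a decision that is improbable under \<open>Q\<close> is unlikely under \<open>P\<close> unless the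
  maximum of \<open>Z\<^sub>1, \<dots>, Z\<^sub>n\<close> is large, which condition (M) excludes with high probability for \<open>n\<close> below the time bound. The
  resulting estimate (\<open>expected_time_lower_bound\<close>, \<open>tests_lower_bound\<close>) is uniform over all tests with the
  given error levels.

  The isolation test is as fast. Let \<open>z\<close> be the minimum of \<open>Z\<^sub>n(P, Q)\<close> over the rivals \<open>Q\<close> at \<open>e\<close>, all on
  the isolation subsystem. Under \<open>P\<close> the logarithm of the isolation statistic of \<open>e\<close> is at least \<open>z\<close> if
  \<open>e\<close> is active, and at most \<open>- z\<close> if it is not (\<open>AE_iso_stat_bound\<close>). So the test can
  go on beyond a time \<open>n\<close> by which all thresholds should have been reached only if some \<open>Z\<^sub>n(P, Q)\<close> is below
  its linear trend. By condition (CC) the probabilities of this are summable, and the expected delay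
  is bounded (\<open>expected_T_star_le\<close>). The condition on the isolation subsystems says that restricting
  attention to them does not lower the rates that matter (\<open>isolation_time_le\<close>).

  If all admissible sets of active units have the same size, a law with a different active set
  is a rival both at an active and at an inactive unit. The two groups of units then have the same
  hardest rival and only the smaller of \<open>\<gamma>\<close> and \<open>\<delta>\<close> matters (\<open>time_bound_card\<close>).
\<close>

section \<open>Densities\<close>

text \<open>
  A density of \<open>p\<close> vanishes only on a set that \<open>p\<close> does not charge. The statement is about \<open>p\<close>-almost
  all points, although the derivative is determined only up to sets that are null for \<open>q\<close>; this is
  what makes logarithms of likelihood ratios meaningful under the law in the numerator.
\<close>

lemma AE_RN_deriv_pos_finite:
  assumes "sigma_finite_measure q" "sigma_finite_measure p" "sets p = sets q" "absolutely_continuous q p"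
  shows "AE x in p. RN_deriv q p x \<noteq> 0 \<and> RN_deriv q p x \<noteq> \<infinity>"
proof -
  interpret q: sigma_finite_measure q by fact
  have "AE x in q. RN_deriv q p x \<noteq> \<infinity>"
    by (rule q.RN_deriv_finite) (use assms in auto)
  then have fin: "AE x in p. RN_deriv q p x \<noteq> \<infinity>"
    using absolutely_continuous_AE[OF assms(3,4)] by auto
  have "AE x in density q (RN_deriv q p). RN_deriv q p x \<noteq> 0"
    by (subst AE_density) auto
  with fin show ?thesis
    unfolding q.density_RN_deriv[OF assms(4,3)] by auto
qed

lemma RN_deriv_chain:
  assumes "sigma_finite_measure q" "sigma_finite_measure r"
    and "sets p = sets q" "sets q = sets r"
    and "absolutely_continuous q p" "absolutely_continuous r q"
  shows "AE x in r. RN_deriv r p x = RN_deriv r q x * RN_deriv q p x"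
proof -
  interpret q: sigma_finite_measure q by fact
  interpret r: sigma_finite_measure r by fact
  have [measurable]: "RN_deriv q p \<in> borel_measurable r"
    using borel_measurable_RN_deriv[of q p] unfolding measurable_cong_sets[OF assms(4) refl] .
  have "density r (\<lambda>x. RN_deriv r q x * RN_deriv q p x) = density (density r (RN_deriv r q)) (RN_deriv q p)"
    by (subst density_density_eq) auto
  also have "\<dots> = p"
    using assms by (simp add: q.density_RN_deriv r.density_RN_deriv)
  finally have "AE x in r. RN_deriv r q x * RN_deriv q p x = RN_deriv r p x"
    by (intro r.RN_deriv_unique) auto
  then show ?thesis by auto
qed

text \<open>
  Change of measure in its crudest form: integrate the bound on the density over the event.
\<close>

lemma emeasure_le_RN_deriv_bound:
  assumes "sigma_finite_measure q" "sets p = sets q" "absolutely_continuous q p"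
    and "A \<in> sets q" "AE x in q. x \<in> A \<longrightarrow> RN_deriv q p x \<le> c"
  shows "emeasure p A \<le> c * emeasure q A"
proof -
  interpret q: sigma_finite_measure q by fact
  have "emeasure p A = emeasure (density q (RN_deriv q p)) A"
    using assms by (simp add: q.density_RN_deriv)
  also have "\<dots> = (\<integral>\<^sup>+x. RN_deriv q p x * indicator A x \<partial>q)"
    using assms by (intro emeasure_density) auto
  also have "\<dots> \<le> (\<integral>\<^sup>+x. c * indicator A x \<partial>q)"
    using assms(5) by (intro nn_integral_mono_AE) (auto split: split_indicator elim!: eventually_mono)
  also have "\<dots> = c * emeasure q A"
    using assms by (simp add: nn_integral_cmult_indicator)
  finally show ?thesis .
qed

section \<open>Histories and laws of subsystems\<close>

lemma space_history [simp]: "space (history M s n) = space (path_space M s)"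
  by (simp add: history_def)

lemma measurable_restrict_history:
  "(\<lambda>x. restrict x (s \<times> {1..n})) \<in> measurable (history M s n) (PiM (s \<times> {1..n}) (\<lambda>(k, i). obs M k i))"
  unfolding history_def
  by (rule measurable_vimage_algebra1) (auto simp: path_space_def space_PiM PiE_iff)

text \<open>
  The minimality of the history, from which both its inclusions below follow.
\<close>

lemma sets_history_subset:
  assumes "(\<lambda>x. restrict x (s \<times> {1..n})) \<in> measurable N (PiM (s \<times> {1..n}) (\<lambda>(k, i). obs M k i))"
    and "space N = space (path_space M s)"
  shows "sets (history M s n) \<subseteq> sets N"
  unfolding history_def using assms by (intro sets_image_in_sets) auto

lemma sets_history_path_space: "sets (history M s n) \<subseteq> sets (path_space M s)"
  by (rule sets_history_subset) (auto simp: path_space_def intro!: measurable_restrict_subset)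

lemma sets_history_mono:
  assumes "n \<le> m"
  shows "sets (history M s n) \<subseteq> sets (history M s m)"
proof (rule sets_history_subset)
  have "(\<lambda>x. restrict x (s \<times> {1..n})) \<circ> (\<lambda>x. restrict x (s \<times> {1..m}))
     \<in> measurable (history M s m) (PiM (s \<times> {1..n}) (\<lambda>(k, i). obs M k i))"
    using assms
    by (intro measurable_comp[OF measurable_restrict_history] measurable_restrict_subset) auto
  also have "(\<lambda>x. restrict x (s \<times> {1..n})) \<circ> (\<lambda>x. restrict x (s \<times> {1..m}))
     = (\<lambda>x. restrict x (s \<times> {1..n}))"
    using assms by (intro ext) (auto simp: restrict_def)
  finally show "(\<lambda>x. restrict x (s \<times> {1..n}))
     \<in> measurable (history M s m) (PiM (s \<times> {1..n}) (\<lambda>(k, i). obs M k i))" .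
qed auto

lemma filtration_filt: "filtration (space (path_space M (all_sources M))) (filt M)"
proof
  show "space (filt M i) = space (path_space M (all_sources M))" for i
    by (cases i) (auto simp: filt_def)
  show "sets (filt M i) \<subseteq> sets (filt M j)" if "i \<le> j" for i j
    using that sets_history_mono[of "the_enat i" "the_enat j" M] sets_history_path_space[of M _ "the_enat i"]
    by (cases i; cases j) (simp_all add: filt_def)
qed

definition on_paths :: "'b problem \<Rightarrow> nat set \<Rightarrow> 'b path measure \<Rightarrow> bool" where
  "on_paths M s P \<longleftrightarrow> prob_space P \<and> sets P = sets (path_space M s)"

lemma on_paths_dists: "valid_problem M \<Longrightarrow> P \<in> dists M \<Longrightarrow> on_paths M (all_sources M) P"
  by (auto simp: valid_problem_def on_paths_def)

lemma on_pathsD: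
  assumes "on_paths M s P"
  shows "prob_space P" "sets P = sets (path_space M s)" "space P = space (path_space M s)"
  using assms sets_eq_imp_space_eq by (auto simp: on_paths_def)

lemma measurable_subsystem:
  assumes "on_paths M (all_sources M) P" "s \<subseteq> all_sources M"
  shows "subsystem s \<in> measurable P (path_space M s)"
proof -
  have "subsystem s \<in> measurable (path_space M (all_sources M)) (path_space M s)"
    unfolding path_space_def subsystem_def[abs_def] using assms
    by (intro measurable_restrict_subset) auto
  then show ?thesis
    unfolding measurable_cong_sets[OF on_pathsD(2)[OF assms(1)] refl] .
qed

lemma on_paths_law:
  assumes "on_paths M (all_sources M) P" "s \<subseteq> all_sources M"
  shows "on_paths M s (law M s P)"
  unfolding on_paths_def law_def
  using prob_space.prob_space_distr[OF on_pathsD(1)[OF assms(1)] measurable_subsystem[OF assms]] by simp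

lemma subsystem_all_sources:
  assumes "\<omega> \<in> space (path_space M (all_sources M))"
  shows "subsystem (all_sources M) \<omega> = \<omega>"
  using assms by (auto simp: subsystem_def path_space_def space_PiM PiE_def)

text \<open>
  The observed data form the whole sample point, so that tests, which are stated for \<open>P\<close> itself, can
  be combined with likelihood ratios, which are stated for laws of subsystems.
\<close>

lemma law_all_sources:
  assumes "on_paths M (all_sources M) P"
  shows "law M (all_sources M) P = P"
proof -
  have "law M (all_sources M) P = distr P P (\<lambda>x. x)"
    unfolding law_def using on_pathsD[OF assms]
    by (intro distr_cong) (auto simp: subsystem_all_sources)
  then show ?thesis by (simp add: distr_id[unfolded id_def])
qed

section \<open>Likelihood ratios\<close>

lemma subalgebra_history:
  assumes "on_paths M s \<mu>" shows "subalgebra \<mu> (history M s n)"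
  using on_pathsD[OF assms] sets_history_path_space[of M s n] by (simp add: subalgebra_def)

lemma prob_space_restr_history:
  assumes "on_paths M s \<mu>" shows "prob_space (restr_to_subalg \<mu> (history M s n))"
  by (rule prob_space_restr_to_subalg[OF subalgebra_history[OF assms] on_pathsD(1)[OF assms]])

lemma sets_restr_history:
  assumes "on_paths M s \<mu>" shows "sets (restr_to_subalg \<mu> (history M s n)) = sets (history M s n)"
  using assms by (intro sets_restr_to_subalg subalgebra_history)

lemma mutually_ac_sym: "mutually_ac F \<mu> \<nu> \<Longrightarrow> mutually_ac F \<nu> \<mu>"
  by (auto simp: mutually_ac_def)

lemma LR_nonneg: "0 \<le> LR M s n \<mu> \<nu> x"
  by (simp add: LR_def)

lemma measurable_LR:
  assumes "on_paths M s \<nu>"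
  shows "LR M s n \<mu> \<nu> \<in> borel_measurable (history M s n)"
proof -
  have "RN_deriv (restr_to_subalg \<nu> (history M s n)) (restr_to_subalg \<mu> (history M s n))
      \<in> borel_measurable (history M s n)"
    using borel_measurable_RN_deriv[of "restr_to_subalg \<nu> (history M s n)" "restr_to_subalg \<mu> (history M s n)"]
    unfolding measurable_cong_sets[OF sets_restr_history[OF assms] refl] .
  then show ?thesis
    unfolding LR_def[abs_def] by measurable
qed

lemma AE_LR_pos:
  assumes "on_paths M s \<mu>" "on_paths M s \<nu>" "mutually_ac (history M s n) \<mu> \<nu>"
  shows "AE x in \<mu>. 0 < LR M s n \<mu> \<nu> x"
proof (rule AE_restr_to_subalg)
  show "subalgebra \<mu> (history M s n)" using assms(1) by (rule subalgebra_history)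
  have "AE x in restr_to_subalg \<mu> (history M s n).
      RN_deriv (restr_to_subalg \<nu> (history M s n)) (restr_to_subalg \<mu> (history M s n)) x \<noteq> 0 \<and>
      RN_deriv (restr_to_subalg \<nu> (history M s n)) (restr_to_subalg \<mu> (history M s n)) x \<noteq> \<infinity>"
    using assms by (intro AE_RN_deriv_pos_finite prob_space_imp_sigma_finite prob_space_restr_history)
      (auto simp: sets_restr_history mutually_ac_def)
  then show "AE x in restr_to_subalg \<mu> (history M s n). 0 < LR M s n \<mu> \<nu> x"
    by eventually_elim (auto simp: LR_def enn2real_positive_iff less_top zero_less_iff_neq_zero)
qed

text \<open>
  The chain rule for derivatives holds almost everywhere under the last denominator \<open>\<rho>\<close>; absolute
  continuity carries it over to \<open>\<mu>\<close>. It removes the reference law from the isolation statistics.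
\<close>

lemma AE_LR_chain:
  assumes "on_paths M s \<mu>" "on_paths M s \<nu>" "on_paths M s \<rho>"
    and "mutually_ac (history M s n) \<mu> \<nu>" "mutually_ac (history M s n) \<nu> \<rho>" 
  shows "AE x in \<mu>. LR M s n \<mu> \<rho> x = LR M s n \<nu> \<rho> x * LR M s n \<mu> \<nu> x"
proof (rule AE_restr_to_subalg)
  let ?r = "\<lambda>\<mu>. restr_to_subalg \<mu> (history M s n)"
  show "subalgebra \<mu> (history M s n)" using assms(1) by (rule subalgebra_history)
  have ac: "absolutely_continuous (?r \<rho>) (?r \<mu>)"
    using assms(4,5) by (auto simp: mutually_ac_def absolutely_continuous_def)
  have "AE x in ?r \<rho>. RN_deriv (?r \<rho>) (?r \<mu>) x = RN_deriv (?r \<rho>) (?r \<nu>) x * RN_deriv (?r \<nu>) (?r \<mu>) x"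
    using assms by (intro RN_deriv_chain prob_space_imp_sigma_finite prob_space_restr_history)
      (auto simp: sets_restr_history mutually_ac_def)
  then have "AE x in ?r \<mu>. RN_deriv (?r \<rho>) (?r \<mu>) x = RN_deriv (?r \<rho>) (?r \<nu>) x * RN_deriv (?r \<nu>) (?r \<mu>) x"
    using assms by (intro absolutely_continuous_AE[OF _ ac]) (auto simp: sets_restr_history)
  then show "AE x in ?r \<mu>. LR M s n \<mu> \<rho> x = LR M s n \<nu> \<rho> x * LR M s n \<mu> \<nu> x"
    by eventually_elim (auto simp: LR_def enn2real_mult)
qed

lemma emeasure_le_LR_bound:
  assumes "on_paths M s \<mu>" "on_paths M s \<nu>" "mutually_ac (history M s n) \<mu> \<nu>"
    and A: "A \<in> sets (history M s n)" and c: "\<And>x. x \<in> A \<Longrightarrow> LR M s n \<mu> \<nu> x \<le> c"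
  shows "emeasure \<mu> A \<le> ennreal c * emeasure \<nu> A"
proof -
  let ?r = "\<lambda>\<mu>. restr_to_subalg \<mu> (history M s n)"
  have "AE x in ?r \<nu>. RN_deriv (?r \<nu>) (?r \<mu>) x \<noteq> \<infinity>"
    using assms
    by (intro sigma_finite_measure.RN_deriv_finite prob_space_imp_sigma_finite prob_space_restr_history)
      (auto simp: sets_restr_history mutually_ac_def)
  then have "AE x in ?r \<nu>. x \<in> A \<longrightarrow> RN_deriv (?r \<nu>) (?r \<mu>) x \<le> ennreal c"
  proof eventually_elim
    case (elim x)
    then show ?case
      using c[of x] ennreal_leI[of "LR M s n \<mu> \<nu> x" c] by (simp add: LR_def less_top[symmetric])
  qed
  then have "emeasure (?r \<mu>) A \<le> ennreal c * emeasure (?r \<nu>) A"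
    using assms by (intro emeasure_le_RN_deriv_bound prob_space_imp_sigma_finite prob_space_restr_history)
      (auto simp: sets_restr_history mutually_ac_def)
  then show ?thesis
    using assms by (simp add: emeasure_restr_to_subalg subalgebra_history)
qed

section \<open>The rivals of a law\<close>

text \<open>
  The laws under which the decision about \<open>e\<close> that is correct for \<open>P\<close> would be an error. A test must
  rule out all of them before it can decide about \<open>e\<close>. With this notion, active and inactive units are
  treated alike throughout.
\<close>

definition rivals :: "'b problem \<Rightarrow> 'b path measure \<Rightarrow> nat set \<Rightarrow> 'b path measure set" where
  "rivals M P e = (if e \<in> active M P then H_Psi M e else G_Psi M e)"

text \<open>
  The largest probability that a rival may give to the decision about \<open>e\<close> that is correct for \<open>P\<close>: a
  test may declare an inactive unit active with probability \<open>\<gamma>\<close>, and miss an active one with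
  probability \<open>\<delta>\<close>.
\<close>

definition error_level :: "'b problem \<Rightarrow> 'b path measure \<Rightarrow> nat set \<Rightarrow> real \<Rightarrow> real \<Rightarrow> real" where
  "error_level M P e \<gamma> \<delta> = (if e \<in> active M P then \<gamma> else \<delta>)"

lemma active_subset_units: "active M P \<subseteq> units M"
  by (auto simp: active_def)

lemma time_bound_rivals:
  "time_bound M I P \<gamma> \<delta> =
     Max ((\<lambda>e. \<bar>ln (error_level M P e \<gamma> \<delta>)\<bar> / info_min M I (all_sources M) P (rivals M P e)) ` units M)"
proof -
  let ?f = "\<lambda>e. \<bar>ln (error_level M P e \<gamma> \<delta>)\<bar> / info_min M I (all_sources M) P (rivals M P e)"
  have "?f ` units M = ?f ` active M P \<union> ?f ` (units M - active M P)"
    using active_subset_units[of M P] by blast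
  also have "?f ` active M P =
      (\<lambda>e. \<bar>ln \<gamma>\<bar> / info_min M I (all_sources M) P (H_Psi M e)) ` active M P"
    by (intro image_cong) (auto simp: rivals_def error_level_def)
  also have "?f ` (units M - active M P) =
      (\<lambda>e. \<bar>ln \<delta>\<bar> / info_min M I (all_sources M) P (G_Psi M e)) ` (units M - active M P)"
    by (intro image_cong) (auto simp: rivals_def error_level_def)
  finally show ?thesis by (simp add: time_bound_def)
qed

lemma finite_units: "valid_problem M \<Longrightarrow> finite (units M)"
  by (auto simp: valid_problem_def all_sources_def intro: finite_subset)

lemma finite_dists: "valid_problem M \<Longrightarrow> finite (dists M)"
  by (auto simp: valid_problem_def)

lemma rivals_subset: "rivals M P e \<subseteq> P_Psi M"
  by (auto simp: rivals_def H_Psi_def G_Psi_def)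

lemma P_Psi_subset_dists: "P_Psi M \<subseteq> dists M"
  by (auto simp: P_Psi_def)

lemma finite_rivals: "valid_problem M \<Longrightarrow> finite (rivals M P e)"
  by (rule finite_subset[OF order_trans[OF rivals_subset P_Psi_subset_dists] finite_dists])

text \<open>
  A global null law has no active unit, and the empty set is not an admissible configuration. Hence \<open>P\<close>
  itself belongs to \<open>\<H>\<^bsub>\<Psi>,e\<^esub>\<close> for each of its inactive units \<open>e\<close>, which puts it within reach of the
  assumptions on likelihood ratios.
\<close>

lemma P_Psi_not_H_zero:
  assumes "valid_problem M" "{} \<notin> Psi M" "P \<in> P_Psi M"
  shows "P \<notin> H_zero M"
proof
  assume "P \<in> H_zero M"
  then have null: "law M e P \<in> null_laws M e" if "e \<in> units M" for e
    using that by (auto simp: H_zero_def)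
  have "null_laws M e \<inter> alt_laws M e = {}" if "e \<in> units M" for e
    using assms(1) that by (auto simp: valid_problem_def)
  then have "active M P = {}"
    using null by (auto simp: active_def)
  then show False using assms by (auto simp: P_Psi_def)
qed

text \<open>
  Comparability is oriented: the law with the active unit comes first. Of \<open>P\<close> and a rival exactly one
  has \<open>e\<close> active, so that one of the two orders applies; the assumptions on growth are symmetric.
\<close>

lemma rival_comparable:
  assumes "valid_problem M" "{} \<notin> Psi M" "P \<in> P_Psi M" "Q \<in> rivals M P e" "e \<in> units M"
    "e \<subseteq> s" "s \<subseteq> all_sources M"
  shows "comparable M s P Q \<or> comparable M s Q P"
  using assms P_Psi_not_H_zero[OF assms(1-3)]
  by (auto simp: comparable_def rivals_def H_Psi_def G_Psi_def split: if_splits)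

lemma comparable_mutually_ac:
  assumes "standing_ac M" "comparable M s P Q \<or> comparable M s Q P" "1 \<le> n"
  shows "mutually_ac (history M s n) (law M s P) (law M s Q)"
proof -
  have "mutually_ac (history M s n) (law M s P) (law M s Q)" if "comparable M s P Q" for P Q
    using that assms(1,3) unfolding standing_ac_def comparable_def by auto
  then show ?thesis using assms(2) mutually_ac_sym by metis
qed

lemma comparable_H_zero_mutually_ac:
  assumes "standing_ac M" "Q \<in> G_Psi M e \<union> H_Psi M e" "R \<in> H_zero M"
    "e \<in> units M" "e \<subseteq> s" "s \<subseteq> all_sources M" "1 \<le> n"
  shows "mutually_ac (history M s n) (law M s Q) (law M s R)"
  using assms mutually_ac_sym[of "history M s n" "law M s R" "law M s Q"]
  unfolding standing_ac_def by auto

lemma info_min_le: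
  assumes "finite \<Q>" "Q \<in> \<Q>" "comparable M s P Q \<or> comparable M s Q P"
  shows "info_min M I s P \<Q> \<le> I (law M s P) (law M s Q)"
  unfolding info_min_def using assms by (intro Min_le) auto

lemma info_min_attained:
  assumes "finite \<Q>" "Q \<in> \<Q>" "comparable M s P Q \<or> comparable M s Q P"
  obtains Q' where "Q' \<in> \<Q>" "comparable M s P Q' \<or> comparable M s Q' P"
    "info_min M I s P \<Q> = I (law M s P) (law M s Q')"
proof -
  let ?S = "{I (law M s P) (law M s Q) |Q. Q \<in> \<Q> \<and> (comparable M s P Q \<or> comparable M s Q P)}"
  have "Min ?S \<in> ?S"
    using assms by (intro Min_in) auto
  then show ?thesis using that by (auto simp: info_min_def)
qed

section \<open>A lower bound for every test\<close>

text \<open>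
  The event of stopping at time \<open>m\<close> with a given decision is determined by the data up to time \<open>m\<close>, so
  its probabilities under two laws are related by the likelihood ratio at that time.
\<close>

lemma stopping_time_sections:
  assumes T: "stopping_time (filt M) T"
    and D: "D \<in> measurable (filtration.pre_sigma (space (path_space M (all_sources M))) (filt M) T)
                    (count_space (Psi M))"
    and m: "1 \<le> m"
  shows "{\<omega> \<in> space (path_space M (all_sources M)). T \<omega> = enat m \<and> D \<omega> \<in> E}
    \<in> sets (history M (all_sources M) m)" (is "?A \<in> _")
    and "D -` E \<inter> space (path_space M (all_sources M)) \<in> sets (path_space M (all_sources M))"
proof -
  let ?\<Omega> = "space (path_space M (all_sources M))"
  interpret filtration ?\<Omega> "filt M" by (rule filtration_filt)
  define B where "B = D -` E \<inter> ?\<Omega>"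
  have "D -` (E \<inter> Psi M) \<inter> space (pre_sigma T) \<in> sets (pre_sigma T)"
    by (rule measurable_sets[OF D]) auto
  moreover have "D -` (E \<inter> Psi M) \<inter> space (pre_sigma T) = B"
    using measurable_space[OF D] by (auto simp: space_pre_sigma B_def)
  ultimately have B: "B \<in> sets (pre_sigma T)" by simp
  have le: "{\<omega>\<in>B. T \<omega> \<le> enat k} \<in> sets (history M (all_sources M) k)" for k
    using sets_pre_sigmaD[OF T B, of "enat k"] by (simp add: filt_def)
  have "{\<omega>\<in>B. T \<omega> \<le> enat m} - {\<omega>\<in>B. T \<omega> \<le> enat (m - 1)} \<in> sets (history M (all_sources M) m)"
    using le[of m] le[of "m - 1"] sets_history_mono[of "m - 1" m M "all_sources M"] by auto
  also have "{\<omega>\<in>B. T \<omega> \<le> enat m} - {\<omega>\<in>B. T \<omega> \<le> enat (m - 1)} = ?A"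
  proof -
    have "t \<le> enat m \<and> \<not> t \<le> enat (m - 1) \<longleftrightarrow> t = enat m" for t
      using m by (cases t) auto
    then show ?thesis by (auto simp: B_def)
  qed
  finally show "?A \<in> sets (history M (all_sources M) m)" .
  have "{\<omega>\<in>B. T \<omega> \<le> \<infinity>} \<in> sets (filt M \<infinity>)" by (rule sets_pre_sigmaD[OF T B])
  then show "D -` E \<inter> ?\<Omega> \<in> sets (path_space M (all_sources M))"
    by (simp add: filt_def B_def Int_def)
qed

lemma measurable_LLR:
  assumes "on_paths M (all_sources M) P" "on_paths M (all_sources M) P'" "on_paths M (all_sources M) Q"
    "s \<subseteq> all_sources M"
  shows "LLR M s n P Q \<in> borel_measurable P'"
proof -
  have "LR M s n (law M s P) (law M s Q) \<in> borel_measurable (path_space M s)"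
    using sets_history_path_space[of M s n]
    by (intro measurable_from_subalg[OF _ measurable_LR[OF on_paths_law[OF assms(3,4)], of n]])
      (simp add: subalgebra_def)
  then have "(\<lambda>\<omega>. ln (LR M s n (law M s P) (law M s Q) (subsystem s \<omega>))) \<in> borel_measurable P'"
    using measurable_subsystem[OF assms(2,4)] by measurable
  then show ?thesis by (simp add: LLR_def[abs_def])
qed

text \<open>
  Split the event on the left by the value \<open>m\<close> of \<open>T\<close>. Either the likelihood ratio has reached \<open>exp c\<close> at
  time \<open>m\<close>, which the first term on the right accounts for, or it has not, and then passing from \<open>P\<close> to
  \<open>Q\<close> on an event of the history at time \<open>m\<close> costs at most the factor \<open>exp c\<close>. The events for distinct
  \<open>m\<close> are disjoint, so their probabilities under \<open>Q\<close> add up to at most that of the decision.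
\<close>

lemma change_of_measure_at_stopping:
  fixes T :: "'b path \<Rightarrow> enat" and D :: "'b path \<Rightarrow> nat set set"
  assumes P: "on_paths M (all_sources M) P" and Q: "on_paths M (all_sources M) Q"
    and ac: "\<And>m. 1 \<le> m \<Longrightarrow> mutually_ac (history M (all_sources M) m) (law M (all_sources M) P) (law M (all_sources M) Q)"
    and T: "stopping_time (filt M) T"
    and T1: "\<forall>\<omega>\<in>space (path_space M (all_sources M)). 1 \<le> T \<omega>"
    and D: "D \<in> measurable (filtration.pre_sigma (space (path_space M (all_sources M))) (filt M) T)
                    (count_space (Psi M))"
  shows "measure P {\<omega> \<in> space P. T \<omega> \<le> enat n \<and> D \<omega> \<in> E}
     \<le> measure P {\<omega> \<in> space P. c \<le> Max ((\<lambda>m. LLR M (all_sources M) m P Q \<omega>) ` {1..n})}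
        + exp c * measure Q {\<omega> \<in> space Q. D \<omega> \<in> E}"
proof -
  let ?S = "all_sources M"
  let ?\<Omega> = "space (path_space M ?S)"
  interpret P: prob_space P using on_pathsD(1)[OF P] .
  interpret Q: prob_space Q using on_pathsD(1)[OF Q] .
  have law: "law M ?S P = P" "law M ?S Q = Q"
    using P Q by (simp_all add: law_all_sources)
  note sp = on_pathsD(3)[OF P] on_pathsD(3)[OF Q]
  note st = on_pathsD(2)[OF P] on_pathsD(2)[OF Q]
  define X where "X m = {\<omega> \<in> ?\<Omega>. T \<omega> = enat m \<and> D \<omega> \<in> E}" for m
  define L where "L m = {\<omega> \<in> ?\<Omega>. exp c \<ge> LR M ?S m P Q \<omega>}" for m
  define W where "W = {\<omega> \<in> space P. c \<le> Max ((\<lambda>m. LLR M ?S m P Q \<omega>) ` {1..n})}"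
  have X: "X m \<in> sets (history M ?S m)" if "1 \<le> m" for m
    unfolding X_def by (rule stopping_time_sections(1)[OF T D that])
  have X': "X m \<in> sets P" "X m \<in> sets Q" if "1 \<le> m" for m
    using X[OF that] sets_history_path_space[of M ?S m] st by auto
  have L: "L m \<in> sets (history M ?S m)" for m
    using measurable_LR[OF Q, of m P] unfolding L_def space_history[symmetric, of M ?S m] by measurable
  have XL: "measure P (X m \<inter> L m) \<le> exp c * measure Q (X m)" if m: "1 \<le> m" for m
  proof -
    have "emeasure P (X m \<inter> L m) \<le> ennreal (exp c) * emeasure Q (X m \<inter> L m)"
      using P Q ac[OF m] X[OF m] L by (intro emeasure_le_LR_bound[where n = m]) (auto simp: law L_def)
    also have "\<dots> \<le> ennreal (exp c) * emeasure Q (X m)"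
      using X'[OF m] by (intro mult_left_mono emeasure_mono) auto
    finally show ?thesis
      by (simp add: P.emeasure_eq_measure Q.emeasure_eq_measure flip: ennreal_mult')
  qed
  have W: "W \<in> sets P"
  proof -
    have [measurable]: "LLR M ?S m P Q \<in> borel_measurable P" for m
      using P Q by (intro measurable_LLR) auto
    have "(\<lambda>\<omega>. Max ((\<lambda>m. LLR M ?S m P Q \<omega>) ` {1..n})) \<in> borel_measurable P"
      by (intro borel_measurable_Max) auto
    then show ?thesis unfolding W_def by measurable
  qed
  have cover: "{\<omega> \<in> space P. T \<omega> \<le> enat n \<and> D \<omega> \<in> E} \<subseteq> W \<union> (\<Union>m\<in>{1..n}. X m \<inter> L m)"
  proof
    fix \<omega> assume "\<omega> \<in> {\<omega> \<in> space P. T \<omega> \<le> enat n \<and> D \<omega> \<in> E}"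
    then have \<omega>: "\<omega> \<in> ?\<Omega>" "T \<omega> \<le> enat n" "D \<omega> \<in> E" by (auto simp: sp)
    from \<omega>(2) obtain m where m: "T \<omega> = enat m" "m \<le> n" by (cases "T \<omega>") auto
    have "enat 1 \<le> enat m" using T1 \<omega>(1) m(1) by (metis one_enat_def)
    then have m1: "1 \<le> m" by simp
    show "\<omega> \<in> W \<union> (\<Union>m\<in>{1..n}. X m \<inter> L m)"
    proof (cases "c \<le> LLR M ?S m P Q \<omega>")
      case True
      have "LLR M ?S m P Q \<omega> \<le> Max ((\<lambda>m. LLR M ?S m P Q \<omega>) ` {1..n})"
        using m m1 by (intro Max_ge) auto
      with True show ?thesis using \<omega> by (auto simp: W_def sp)
    next
      case False
      then have "ln (LR M ?S m P Q \<omega>) < c"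
        using \<omega> by (simp add: LLR_def law subsystem_all_sources)
      then have "LR M ?S m P Q \<omega> \<le> exp c"
        using ln_ge_iff[of "LR M ?S m P Q \<omega>" c] LR_nonneg[of M ?S m P Q \<omega>]
        by (cases "LR M ?S m P Q \<omega> = 0") auto
      then show ?thesis using \<omega> m m1 by (auto simp: X_def L_def)
    qed
  qed
  have Y: "X m \<inter> L m \<in> sets P" if "1 \<le> m" for m
    using X[OF that] L[of m] sets_history_path_space[of M ?S m] unfolding st by blast
  then have UY: "(\<Union>m\<in>{1..n}. X m \<inter> L m) \<in> sets P"
    by (intro sets.finite_UN) auto
  have disj: "disjoint_family_on X {1..n}" by (auto simp: disjoint_family_on_def X_def)
  have "measure P {\<omega> \<in> space P. T \<omega> \<le> enat n \<and> D \<omega> \<in> E} \<le> measure P (W \<union> (\<Union>m\<in>{1..n}. X m \<inter> L m))"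
    using cover W UY by (intro P.finite_measure_mono) auto
  also have "\<dots> \<le> measure P W + measure P (\<Union>m\<in>{1..n}. X m \<inter> L m)"
    using W UY by (intro measure_Un_le) auto
  also have "measure P (\<Union>m\<in>{1..n}. X m \<inter> L m) \<le> (\<Sum>m\<in>{1..n}. measure P (X m \<inter> L m))"
    using Y by (intro measure_UNION_le) auto
  also have "\<dots> \<le> (\<Sum>m\<in>{1..n}. exp c * measure Q (X m))"
    by (intro sum_mono XL) simp
  also have "\<dots> = exp c * measure Q (\<Union>m\<in>{1..n}. X m)"
    using X' disj by (subst Q.finite_measure_finite_Union) (auto simp: sum_distrib_left)
  also have "measure Q (\<Union>m\<in>{1..n}. X m) \<le> measure Q {\<omega> \<in> space Q. D \<omega> \<in> E}"
  proof (rule Q.finite_measure_mono)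
    show "(\<Union>m\<in>{1..n}. X m) \<subseteq> {\<omega> \<in> space Q. D \<omega> \<in> E}" by (auto simp: X_def sp)
    have "D -` E \<inter> ?\<Omega> \<in> sets Q"
      using stopping_time_sections(2)[OF T D, of 1 E] by (simp add: st)
    also have "D -` E \<inter> ?\<Omega> = {\<omega> \<in> space Q. D \<omega> \<in> E}" by (auto simp: sp)
    finally show "{\<omega> \<in> space Q. D \<omega> \<in> E} \<in> sets Q" .
  qed
  finally show ?thesis by (simp add: W_def)
qed

lemma filterlim_abs_ln_at_right_0: "filterlim (\<lambda>x::real. \<bar>ln x\<bar>) at_top (at_right 0)"
  by (rule filterlim_at_top_mono[OF iffD1[OF filterlim_uminus_at_bot ln_at_0]])
    (auto intro: always_eventually)

text \<open>
  Markov's inequality. A time that exceeds \<open>n\<close> is at least \<open>n + 1\<close>, so no rounding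
  loss occurs when \<open>a\<close> has the integer part \<open>n\<close>.
\<close>

lemma expected_time_ge:
  assumes "prob_space P" "{\<omega> \<in> space P. enat n < T \<omega>} \<in> sets P" "0 \<le> a" "a \<le> real n + 1"
  shows "ennreal (a * measure P {\<omega> \<in> space P. enat n < T \<omega>}) \<le> expected_time P T"
proof -
  interpret prob_space P by fact
  let ?S = "{\<omega> \<in> space P. enat n < T \<omega>}"
  have "ennreal (a * measure P ?S) = (\<integral>\<^sup>+ \<omega>. ennreal a * indicator ?S \<omega> \<partial>P)"
    using assms by (simp add: nn_integral_cmult_indicator emeasure_eq_measure ennreal_mult)
  also have "\<dots> \<le> expected_time P T"
    unfolding expected_time_def
  proof (intro nn_integral_mono)
    fix \<omega> assume "\<omega> \<in> space P"
    show "ennreal a * indicator ?S \<omega> \<le> ennreal_of_enat (T \<omega>)"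
    proof (cases "\<omega> \<in> ?S")
      case True
      show ?thesis
      proof (cases "T \<omega>")
        case (enat k)
        then have "Suc n \<le> k" using True by auto
        then have "a \<le> real k" using assms(4) by linarith
        then show ?thesis using True enat
          by (simp add: ennreal_of_nat_eq_real_of_nat ennreal_leI)
      qed simp
    qed simp
  qed
  finally show ?thesis .
qed

text \<open>
  A decision in \<open>E\<close> that has probability at most \<open>x\<close> under \<open>Q\<close> but is the likely one under \<open>P\<close> cannot be
  reached before the log-likelihood ratio has had time to grow to about \<open>\<bar>ln x\<bar>\<close>, and under \<open>P\<close> its
  maximum grows at rate at most \<open>i\<close>. Formally, the change of measure is applied at
  \<open>n = \<lfloor>(1 - \<epsilon>) \<bar>ln x\<bar> / i\<rfloor>\<close> and \<open>c = n (1 + \<epsilon>) i\<close>. The first error term is small by the bound on the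
  growth, and the second is at most \<open>exp c \<cdot> x \<le> exp (- \<epsilon>\<^sup>2 \<bar>ln x\<bar>)\<close>. The threshold for \<open>x\<close> depends only on
  the pair of laws and \<open>\<epsilon>\<close>, and not on the test, so that the bound survives the infimum over all tests.
\<close>

lemma expected_time_lower_bound:
  fixes P Q :: "'b path measure"
  assumes P: "on_paths M (all_sources M) P" and Q: "on_paths M (all_sources M) Q"
    and ac: "\<And>m. 1 \<le> m \<Longrightarrow> mutually_ac (history M (all_sources M) m) (law M (all_sources M) P) (law M (all_sources M) Q)"
    and i: "0 < i"
    and growth: "\<And>\<rho>. i < \<rho> \<Longrightarrow> (\<lambda>n. measure P {\<omega> \<in> space P.
            real n * \<rho> \<le> Max ((\<lambda>m. LLR M (all_sources M) m P Q \<omega>) ` {1..n})}) \<longlonglongrightarrow> 0"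
    and \<epsilon>: "0 < \<epsilon>" "\<epsilon> < 1"
  shows "\<forall>\<^sub>F x in at_right 0. \<forall>T D E \<alpha>.
    stopping_time (filt M) T \<and> (\<forall>\<omega>\<in>space (path_space M (all_sources M)). 1 \<le> T \<omega>) \<and>
    D \<in> measurable (filtration.pre_sigma (space (path_space M (all_sources M))) (filt M) T)
                    (count_space (Psi M)) \<and>
    measure Q {\<omega> \<in> space Q. D \<omega> \<in> E} \<le> x \<and> measure P {\<omega> \<in> space P. D \<omega> \<notin> E} \<le> \<alpha> \<longrightarrow>
    ennreal ((1 - \<epsilon>) * (\<bar>ln x\<bar> / i) * (1 - \<alpha> - \<epsilon>)) \<le> expected_time P T"
proof -
  let ?S = "all_sources M"
  let ?\<Omega> = "space (path_space M ?S)"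
  interpret P: prob_space P using on_pathsD(1)[OF P] .
  define \<rho> where "\<rho> = (1 + \<epsilon>) * i"
  \<comment> \<open>\<open>\<rho>\<close> exceeds \<open>i\<close>, yet \<open>a x * \<rho>\<close> stays below \<open>\<bar>ln x\<bar>\<close> by the factor \<open>1 - \<epsilon>\<^sup>2\<close>.\<close>
  define a where "a x = (1 - \<epsilon>) * (\<bar>ln x\<bar> / i)" for x :: real
  define n where "n x = nat \<lfloor>a x\<rfloor>" for x
  define W where "W n = measure P {\<omega> \<in> space P.
            real n * \<rho> \<le> Max ((\<lambda>m. LLR M ?S m P Q \<omega>) ` {1..n})}" for n
  have a_top: "filterlim a at_top (at_right 0)"
    unfolding a_def divide_inverse using i \<epsilon>
    by (intro filterlim_tendsto_pos_mult_at_top[OF tendsto_const]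
        filterlim_at_top_mult_tendsto_pos[OF tendsto_const] filterlim_abs_ln_at_right_0) auto
  have "filterlim n sequentially (at_right 0)"
    unfolding n_def
    by (intro filterlim_compose[OF filterlim_nat_sequentially]
        filterlim_compose[OF filterlim_floor_sequentially a_top])
  moreover have "W \<longlonglongrightarrow> 0"
    unfolding W_def using i \<epsilon> by (intro growth) (simp add: \<rho>_def)
  ultimately have "((\<lambda>x. W (n x)) \<longlongrightarrow> 0) (at_right 0)"
    by (rule filterlim_compose[rotated])
  then have ev1: "\<forall>\<^sub>F x in at_right 0. W (n x) < \<epsilon> / 2"
    using \<epsilon> by (intro order_tendstoD(2)) auto
  have ev2: "\<forall>\<^sub>F x::real in at_right 0. - ln (\<epsilon> / 2) / \<epsilon>\<^sup>2 \<le> \<bar>ln x\<bar>"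
    using filterlim_abs_ln_at_right_0 by (simp add: filterlim_at_top)
  have ev3: "\<forall>\<^sub>F x::real in at_right 0. x \<in> {0<..<1}"
    by (rule eventually_at_right_real) simp
  from ev1 ev2 ev3 show ?thesis
  proof eventually_elim
    case (elim x)
    show ?case
    proof (intro allI impI, elim conjE)
      fix T D E \<alpha>
      assume T: "stopping_time (filt M) T" and T1: "\<forall>\<omega>\<in>?\<Omega>. 1 \<le> T \<omega>"
        and D: "D \<in> measurable (filtration.pre_sigma ?\<Omega> (filt M) T) (count_space (Psi M))"
        and err: "measure Q {\<omega> \<in> space Q. D \<omega> \<in> E} \<le> x" "measure P {\<omega> \<in> space P. D \<omega> \<notin> E} \<le> \<alpha>"
      have a0: "0 \<le> a x" using i \<epsilon> by (simp add: a_def)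
      have n: "real (n x) \<le> a x" "a x \<le> real (n x) + 1"
        using a0 unfolding n_def by linarith+
      have "exp (real (n x) * \<rho>) * x \<le> exp (a x * \<rho>) * x"
        using n i \<epsilon> elim by (intro mult_right_mono) (auto simp: \<rho>_def)
      also have "a x * \<rho> = (1 - \<epsilon>\<^sup>2) * \<bar>ln x\<bar>"
        using i by (simp add: a_def \<rho>_def power2_eq_square field_simps)
      also have "exp ((1 - \<epsilon>\<^sup>2) * \<bar>ln x\<bar>) * x = exp ((1 - \<epsilon>\<^sup>2) * \<bar>ln x\<bar> + ln x)"
        unfolding exp_add using elim by simp
      also have "(1 - \<epsilon>\<^sup>2) * \<bar>ln x\<bar> + ln x = - (\<epsilon>\<^sup>2 * \<bar>ln x\<bar>)"
        using elim by (simp add: algebra_simps)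
      also have "exp (- (\<epsilon>\<^sup>2 * \<bar>ln x\<bar>)) \<le> exp (ln (\<epsilon> / 2))"
      proof (subst exp_le_cancel_iff)
        have "- ln (\<epsilon> / 2) \<le> \<bar>ln x\<bar> * \<epsilon>\<^sup>2"
          using \<epsilon> by (intro iffD1[OF pos_divide_le_eq elim(2)]) simp
        then show "- (\<epsilon>\<^sup>2 * \<bar>ln x\<bar>) \<le> ln (\<epsilon> / 2)" by (simp add: mult.commute)
      qed
      also have "\<dots> = \<epsilon> / 2" using \<epsilon> by simp
      finally have small: "exp (real (n x) * \<rho>) * x \<le> \<epsilon> / 2" .
      have "measure P {\<omega> \<in> space P. T \<omega> \<le> enat (n x) \<and> D \<omega> \<in> E}
          \<le> W (n x) + exp (real (n x) * \<rho>) * measure Q {\<omega> \<in> space Q. D \<omega> \<in> E}"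
        unfolding W_def by (rule change_of_measure_at_stopping[OF P Q ac T T1 D])
      also have "exp (real (n x) * \<rho>) * measure Q {\<omega> \<in> space Q. D \<omega> \<in> E} \<le> exp (real (n x) * \<rho>) * x"
        using err by simp
      finally have early: "measure P {\<omega> \<in> space P. T \<omega> \<le> enat (n x) \<and> D \<omega> \<in> E} \<le> \<epsilon>"
        using small elim(1) by simp
      have le: "{\<omega> \<in> space P. T \<omega> \<le> enat (n x)} \<in> sets P"
        using stopping_timeD[OF T, of "enat (n x)"] sets_history_path_space[of M ?S "n x"]
        unfolding on_pathsD(2,3)[OF P] by (auto simp: filt_def pred_def)
      have DE: "{\<omega> \<in> space P. D \<omega> \<in> E} \<in> sets P" for E
        using stopping_time_sections(2)[OF T D, of 1 E]
        unfolding on_pathsD(2,3)[OF P] by (simp add: vimage_def Int_def conj_commute)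
      have gt: "{\<omega> \<in> space P. enat (n x) < T \<omega>} = space P - {\<omega> \<in> space P. T \<omega> \<le> enat (n x)}"
        by auto
      have mid: "{\<omega> \<in> space P. T \<omega> \<le> enat (n x) \<and> D \<omega> \<in> E} \<in> sets P"
        using sets.Int[OF le DE[of E]] by (simp add: Int_def conj_ac)
      have "1 = measure P ({\<omega> \<in> space P. enat (n x) < T \<omega>} \<union>
          ({\<omega> \<in> space P. D \<omega> \<notin> E} \<union> {\<omega> \<in> space P. T \<omega> \<le> enat (n x) \<and> D \<omega> \<in> E}))"
        unfolding P.prob_space[symmetric] by (rule arg_cong[where f = "measure P"]) auto
      also have "\<dots> \<le> measure P {\<omega> \<in> space P. enat (n x) < T \<omega>} + 
          (measure P {\<omega> \<in> space P. D \<omega> \<notin> E} + measure P {\<omega> \<in> space P. T \<omega> \<le> enat (n x) \<and> D \<omega> \<in> E})"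
        using le DE[of "- E"] mid
        by (intro order_trans[OF measure_Un_le] add_left_mono measure_Un_le) (auto simp: gt)
      finally have "1 - \<alpha> - \<epsilon> \<le> measure P {\<omega> \<in> space P. enat (n x) < T \<omega>}"
        using early err by simp
      then have "ennreal (a x * (1 - \<alpha> - \<epsilon>)) \<le> ennreal (a x * measure P {\<omega> \<in> space P. enat (n x) < T \<omega>})"
        using a0 by (intro ennreal_leI mult_left_mono)
      also have "\<dots> \<le> expected_time P T"
        using a0 n le by (intro expected_time_ge P.prob_space_axioms) (auto simp: gt)
      finally show "ennreal ((1 - \<epsilon>) * (\<bar>ln x\<bar> / i) * (1 - \<alpha> - \<epsilon>)) \<le> expected_time P T"
        by (simp add: a_def)
    qed
  qed
qed

lemma errors_to_0_eventually:
  "(\<forall>\<^sub>F p in errors_to_0. fst p \<in> {0<..<c} \<and> snd p \<in> {0<..<c})" if "0 < c" for c :: real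
  unfolding errors_to_0_def
  by (intro eventually_conj eventually_compose_filterlim[OF _ filterlim_fst]
      eventually_compose_filterlim[OF _ filterlim_snd] eventually_at_right_real that)

lemma filterlim_error_level:
  "filterlim (\<lambda>p. error_level M P e (fst p) (snd p)) (at_right 0) errors_to_0"
  using filterlim_fst[of "at_right (0::real)" "at_right (0::real)"]
    filterlim_snd[of "at_right (0::real)" "at_right (0::real)"]
  by (cases "e \<in> active M P") (auto simp: error_level_def errors_to_0_def)

text \<open>
  For an active unit \<open>e\<close> the decisive event is \<open>e \<in> D\<close>, a false inclusion under the rival; for an
  inactive one it is \<open>e \<notin> D\<close>, a missed unit under the rival. Since decisions in \<open>\<Psi>\<close> are never empty,
  missing \<open>e\<close> always counts as an error of the second kind. Under \<open>P\<close> the complementary event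
  is itself an error, of probability at most \<open>\<gamma>\<close> or \<open>\<delta>\<close>.
\<close>

lemma tests_lower_bound_rival:
  assumes M: "valid_problem M" "standing_ac M" "{} \<notin> Psi M" "positive_info M I" "condition_M M I"
    and P: "P \<in> P_Psi M" and e: "e \<in> units M" and Q: "Q \<in> rivals M P e"
    and \<epsilon>: "0 < \<epsilon>" "\<epsilon> < 1/2"
  shows "\<forall>\<^sub>F p in errors_to_0. \<forall>(T, D) \<in> tests M (fst p) (snd p).
    ennreal ((1 - 2 * \<epsilon>)\<^sup>2 * (\<bar>ln (error_level M P e (fst p) (snd p))\<bar> /
        I (law M (all_sources M) P) (law M (all_sources M) Q))) \<le> expected_time P T"
proof -
  let ?S = "all_sources M"
  let ?\<Omega> = "space (path_space M ?S)"
  have onP: "on_paths M ?S P" and onQ: "on_paths M ?S Q"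
    using on_paths_dists[OF M(1)] P Q P_Psi_subset_dists rivals_subset by blast+
  have eS: "e \<subseteq> ?S" using M(1) e by (auto simp: valid_problem_def)
  have cmp: "comparable M ?S P Q \<or> comparable M ?S Q P"
    using rival_comparable[OF M(1,3) P Q e eS] by simp
  define i where "i = I (law M ?S P) (law M ?S Q)"
  define E where "E = (if e \<in> active M P then {d. e \<in> d} else {d. e \<notin> d})"
  have "0 < i" using cmp M(4) by (auto simp: positive_info_def i_def)
  moreover have "max_growth M I ?S P Q" using cmp M(5) by (auto simp: condition_M_def)
  ultimately have "\<forall>\<^sub>F x in at_right 0. \<forall>T D E \<alpha>.
    stopping_time (filt M) T \<and> (\<forall>\<omega>\<in>?\<Omega>. 1 \<le> T \<omega>) \<and>
    D \<in> measurable (filtration.pre_sigma ?\<Omega> (filt M) T) (count_space (Psi M)) \<and>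
    measure Q {\<omega> \<in> space Q. D \<omega> \<in> E} \<le> x \<and> measure P {\<omega> \<in> space P. D \<omega> \<notin> E} \<le> \<alpha> \<longrightarrow>
    ennreal ((1 - \<epsilon>) * (\<bar>ln x\<bar> / i) * (1 - \<alpha> - \<epsilon>)) \<le> expected_time P T"
    using \<epsilon> by (intro expected_time_lower_bound onP onQ comparable_mutually_ac[OF M(2) cmp])
      (auto simp: max_growth_def i_def)
  from eventually_compose_filterlim[OF this filterlim_error_level[of M P e]]
    errors_to_0_eventually[of \<epsilon>, OF \<epsilon>(1)]
  show ?thesis
  proof eventually_elim
    case (elim p)
    let ?l = "error_level M P e (fst p) (snd p)"
    show ?case
    proof safe
      fix T D assume TD: "(T, D) \<in> tests M (fst p) (snd p)"
      have T: "stopping_time (filt M) T" "\<forall>\<omega>\<in>?\<Omega>. 1 \<le> T \<omega>"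
        and D: "D \<in> measurable (filtration.pre_sigma ?\<Omega> (filt M) T) (count_space (Psi M))"
        using TD by (auto simp: tests_def)
      have err: "measure R {\<omega> \<in> space R. D \<omega> - active M R \<noteq> {}} \<le> fst p"
        "measure R {\<omega> \<in> space R. active M R - D \<omega> \<noteq> {} \<and> D \<omega> \<noteq> {}} \<le> snd p" if "R \<in> P_Psi M" for R
        using TD that by (auto simp: tests_def)
      interpret filtration ?\<Omega> "filt M" by (rule filtration_filt)
      have ne: "D \<omega> \<noteq> {}" if "\<omega> \<in> ?\<Omega>" for \<omega>
        using measurable_space[OF D, of \<omega>] that M(3) by (auto simp: space_pre_sigma)
      have sub: "measure R {\<omega> \<in> space R. D \<omega> \<in> F} \<le> measure R {\<omega> \<in> space R. D \<omega> \<in> G}"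
        if "on_paths M ?S R" "\<And>\<omega>. \<omega> \<in> ?\<Omega> \<Longrightarrow> D \<omega> \<in> F \<Longrightarrow> D \<omega> \<in> G" for R F G
      proof -
        interpret R: prob_space R using on_pathsD(1)[OF that(1)] .
        have "{\<omega> \<in> space R. D \<omega> \<in> G} \<in> sets R"
          using stopping_time_sections(2)[OF T(1) D, of 1 G]
          unfolding on_pathsD(2,3)[OF that(1)] by (simp add: vimage_def Int_def conj_commute)
        then show ?thesis
          using that(2) on_pathsD(3)[OF that(1)] by (intro R.finite_measure_mono) auto
      qed
      have PQ: "P \<in> P_Psi M" "Q \<in> P_Psi M" using P Q rivals_subset by blast+
      have "measure Q {\<omega> \<in> space Q. D \<omega> \<in> E} \<le> ?l \<and> measure P {\<omega> \<in> space P. D \<omega> \<in> - E} \<le> \<epsilon>"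
      proof (cases "e \<in> active M P")
        case True
        then have eQ: "e \<notin> active M Q" using Q by (auto simp: rivals_def H_Psi_def)
        have "measure Q {\<omega> \<in> space Q. D \<omega> \<in> E} \<le> measure Q {\<omega> \<in> space Q. D \<omega> \<in> {d. d - active M Q \<noteq> {}}}"
          using True eQ by (intro sub onQ) (auto simp: E_def)
        moreover have "measure P {\<omega> \<in> space P. D \<omega> \<in> - E}
            \<le> measure P {\<omega> \<in> space P. D \<omega> \<in> {d. active M P - d \<noteq> {} \<and> d \<noteq> {}}}"
          using True ne by (intro sub onP) (auto simp: E_def)
        ultimately show ?thesis
          using err(1)[OF PQ(2)] err(2)[OF PQ(1)] True elim(2) by (simp add: error_level_def)
      next
        case False
        then have eQ: "e \<in> active M Q" using Q by (auto simp: rivals_def G_Psi_def)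
        have "measure Q {\<omega> \<in> space Q. D \<omega> \<in> E}
            \<le> measure Q {\<omega> \<in> space Q. D \<omega> \<in> {d. active M Q - d \<noteq> {} \<and> d \<noteq> {}}}"
          using False eQ ne by (intro sub onQ) (auto simp: E_def)
        moreover have "measure P {\<omega> \<in> space P. D \<omega> \<in> - E}
            \<le> measure P {\<omega> \<in> space P. D \<omega> \<in> {d. d - active M P \<noteq> {}}}"
          using False by (intro sub onP) (auto simp: E_def)
        ultimately show ?thesis
          using err(2)[OF PQ(2)] err(1)[OF PQ(1)] False elim(2) by (simp add: error_level_def)
      qed
      then have "ennreal ((1 - \<epsilon>) * (\<bar>ln ?l\<bar> / i) * (1 - \<epsilon> - \<epsilon>)) \<le> expected_time P T"
        using T D by (intro elim(1)[rule_format, of T D E \<epsilon>]) auto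
      moreover have "(1 - 2 * \<epsilon>)\<^sup>2 * (\<bar>ln ?l\<bar> / i) \<le> (1 - \<epsilon>) * (\<bar>ln ?l\<bar> / i) * (1 - \<epsilon> - \<epsilon>)"
      proof -
        have "(1 - 2 * \<epsilon>) * (1 - 2 * \<epsilon>) \<le> (1 - \<epsilon>) * (1 - \<epsilon> - \<epsilon>)"
          using \<epsilon> by (intro mult_mono) auto
        then have "(1 - 2 * \<epsilon>) * (1 - 2 * \<epsilon>) * (\<bar>ln ?l\<bar> / i) \<le> (1 - \<epsilon>) * (1 - \<epsilon> - \<epsilon>) * (\<bar>ln ?l\<bar> / i)"
          using \<open>0 < i\<close> by (rule_tac mult_right_mono) auto
        then show ?thesis by (simp only: power2_eq_square mult_ac)
      qed
      ultimately show "ennreal ((1 - 2 * \<epsilon>)\<^sup>2 * (\<bar>ln ?l\<bar> / I (law M ?S P) (law M ?S Q))) \<le> expected_time P T"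
        unfolding i_def[symmetric] using ennreal_leI order_trans by blast
    qed
  qed
qed

section \<open>Expected duration of the isolation test\<close>

text \<open>
  Let \<open>e\<close> be active. The numerator of the isolation statistic is at least the likelihood of \<open>P\<close> and the
  denominator is the likelihood of some rival, so by the chain rule the statistic is at least
  \<open>min\<^sub>Q \<Lambda>\<^sub>n(P, Q)\<close> over the rivals \<open>Q\<close>, whatever the reference law. For an inactive \<open>e\<close> the roles of
  numerator and denominator are exchanged, and the statistic is at most the reciprocal.
\<close>

lemma AE_iso_stat_bound:
  assumes M: "valid_problem M" "standing_ac M" "{} \<notin> Psi M"
    and P: "P \<in> P_Psi M" and e: "e \<in> units M" and s: "e \<subseteq> s' e" "s' e \<subseteq> all_sources M"
    and ne: "G_Psi M e \<noteq> {}" "H_Psi M e \<noteq> {}" and P0: "P0 e \<in> law M (s' e) ` H_zero M"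
    and n: "1 \<le> n"
  shows "AE \<omega> in P. \<forall>z. (\<forall>Q\<in>rivals M P e. z \<le> LLR M (s' e) n P Q \<omega>) \<longrightarrow>
    (if e \<in> active M P then exp z \<le> iso_stat M s' P0 e n \<omega> else iso_stat M s' P0 e n \<omega> \<le> exp (- z))"
proof -
  let ?s = "s' e"
  obtain R where R: "R \<in> H_zero M" "P0 e = law M ?s R" using P0 by auto
  have on: "on_paths M (all_sources M) Q" if "Q \<in> dists M" for Q
    using that M(1) by (rule on_paths_dists[rotated])
  have onP: "on_paths M (all_sources M) P" using P by (intro on) (auto simp: P_Psi_def)
  have on': "on_paths M ?s (law M ?s Q)" if "Q \<in> dists M" for Q
    using on[OF that] s(2) by (rule on_paths_law)
  have GH: "P \<in> G_Psi M e \<union> H_Psi M e"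
    using P P_Psi_not_H_zero[OF M(1,3) P] by (auto simp: G_Psi_def H_Psi_def)
  have riv: "rivals M P e \<subseteq> G_Psi M e \<union> H_Psi M e" by (auto simp: rivals_def)
  have dists: "Q \<in> dists M" if "Q \<in> G_Psi M e \<union> H_Psi M e \<union> H_zero M" for Q
    using that by (auto simp: G_Psi_def H_Psi_def P_Psi_def H_zero_def)
  define L where "L Q \<omega> = LR M ?s n (law M ?s Q) (P0 e) (subsystem ?s \<omega>)" for Q \<omega>
  have pull: "AE \<omega> in P. \<phi> (subsystem ?s \<omega>)" if "AE x in law M ?s P. \<phi> x" for \<phi>
    using that measurable_subsystem[OF onP s(2)] unfolding law_def by (rule AE_distrD[rotated])
  have pos: "AE \<omega> in P. 0 < L P \<omega>"
    unfolding L_def R(2) using comparable_H_zero_mutually_ac[OF M(2) GH R(1) e s n] dists GH R(1)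
    by (intro pull AE_LR_pos on') auto
  have chain: "AE \<omega> in P. L P \<omega> = L Q \<omega> * LR M ?s n (law M ?s P) (law M ?s Q) (subsystem ?s \<omega>)"
    if Q: "Q \<in> rivals M P e" for Q
  proof -
    have "mutually_ac (history M ?s n) (law M ?s P) (law M ?s Q)"
      by (rule comparable_mutually_ac[OF M(2) rival_comparable[OF M(1,3) P Q e s] n])
    moreover have "mutually_ac (history M ?s n) (law M ?s Q) (law M ?s R)"
      using riv Q by (intro comparable_H_zero_mutually_ac[OF M(2) _ R(1) e s n]) auto
    ultimately show ?thesis
      unfolding L_def R(2) using riv Q dists GH R(1) by (intro pull AE_LR_chain on') auto
  qed
  have fin: "finite (G_Psi M e)" "finite (H_Psi M e)"
    using finite_dists[OF M(1)] dists by (auto intro: finite_subset)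
  have iso: "iso_stat M s' P0 e n \<omega> = Max ((\<lambda>Q. L Q \<omega>) ` G_Psi M e) / Max ((\<lambda>Q. L Q \<omega>) ` H_Psi M e)" for \<omega>
    by (simp add: iso_stat_def L_def image_image)
  have "AE \<omega> in P. \<forall>Q\<in>rivals M P e. L P \<omega> = L Q \<omega> * LR M ?s n (law M ?s P) (law M ?s Q) (subsystem ?s \<omega>)"
    using finite_rivals[OF M(1)] chain by (intro AE_finite_allI) auto
  with pos show ?thesis
  proof eventually_elim
    case (elim \<omega>)
    show ?case
    proof (intro allI impI)
      fix z assume z: "\<forall>Q\<in>rivals M P e. z \<le> LLR M ?s n P Q \<omega>"
      have bd: "0 < L Q \<omega> \<and> exp z * L Q \<omega> \<le> L P \<omega>" if Q: "Q \<in> rivals M P e" for Q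
      proof -
        let ?l = "LR M ?s n (law M ?s P) (law M ?s Q) (subsystem ?s \<omega>)"
        have eq: "L P \<omega> = L Q \<omega> * ?l" using elim(2) Q by blast
        have nn: "0 \<le> L Q \<omega>" "0 \<le> ?l" by (auto simp: L_def LR_nonneg)
        then have l: "0 < L Q \<omega>" "0 < ?l" using elim(1) eq by (auto simp: zero_less_mult_iff)
        moreover have "z \<le> ln ?l" using z Q by (auto simp: LLR_def)
        then have "exp z \<le> ?l" using l(2) by (simp add: ln_ge_iff)
        then have "exp z * L Q \<omega> \<le> ?l * L Q \<omega>" using l by (intro mult_right_mono) auto
        ultimately show ?thesis using eq by (simp add: mult.commute)
      qed
      let ?G = "Max ((\<lambda>Q. L Q \<omega>) ` G_Psi M e)" and ?H = "Max ((\<lambda>Q. L Q \<omega>) ` H_Psi M e)"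
      show "if e \<in> active M P then exp z \<le> iso_stat M s' P0 e n \<omega> else iso_stat M s' P0 e n \<omega> \<le> exp (- z)"
      proof (cases "e \<in> active M P")
        case True
        then have r: "rivals M P e = H_Psi M e" and PG: "P \<in> G_Psi M e"
          using P by (auto simp: rivals_def G_Psi_def)
        have "?H \<in> (\<lambda>Q. L Q \<omega>) ` H_Psi M e" using fin ne by (intro Max_in) auto
        then have H: "0 < ?H" "exp z * ?H \<le> L P \<omega>" using bd r by auto
        have "L P \<omega> \<le> ?G" using fin PG by (intro Max_ge) auto
        then have "exp z \<le> ?G / ?H" using H by (simp add: pos_le_divide_eq)
        then show ?thesis using True by (simp add: iso)
      next
        case False
        then have r: "rivals M P e = G_Psi M e" and PH: "P \<in> H_Psi M e"
          using P GH by (auto simp: rivals_def G_Psi_def)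
        have "?G \<in> (\<lambda>Q. L Q \<omega>) ` G_Psi M e" using fin ne by (intro Max_in) auto
        then have G: "exp z * ?G \<le> L P \<omega>" using bd r by auto
        have H: "L P \<omega> \<le> ?H" using fin PH by (intro Max_ge) auto
        have "?G \<le> exp (- z) * ?H" using G H by (simp add: exp_minus field_simps)
        moreover have "0 < ?H" using elim(1) H by simp
        ultimately have "?G / ?H \<le> exp (- z)" by (simp add: pos_divide_le_eq)
        then show ?thesis using False by (simp add: iso)
      qed
    qed
  qed
qed

text \<open>
  If at time \<open>n\<close> all evidence against the rivals is above the thresholds, the isolated set is exactly
  \<open>active M P\<close>, an element of \<open>\<Psi>\<close>, and the stopping rule is met with the correct decision.
\<close>

lemma T_star_le:
  assumes P: "P \<in> P_Psi M" and n: "1 \<le> n"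
    and pos: "\<And>e. e \<in> units M \<Longrightarrow> 0 < z e"
    and thr: "\<And>e. e \<in> units M \<Longrightarrow> 0 < A e \<and> 0 < B e \<and> ln (if e \<in> active M P then B e else A e) \<le> z e"
    and iso: "\<And>e. e \<in> units M \<Longrightarrow> if e \<in> active M P then exp (z e) \<le> iso_stat M s' P0 e n \<omega>
                else iso_stat M s' P0 e n \<omega> \<le> exp (- z e)"
  shows "T_star M s' P0 A B \<omega> \<le> enat n"
proof -
  have act: "B e \<le> iso_stat M s' P0 e n \<omega> \<and> 1 < iso_stat M s' P0 e n \<omega>"
    if e: "e \<in> units M" "e \<in> active M P" for e
  proof -
    have "B e = exp (ln (B e))" using thr[OF e(1)] by simp
    also have "\<dots> \<le> exp (z e)" using thr[OF e(1)] e(2) by (subst exp_le_cancel_iff) simp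
    finally have "B e \<le> exp (z e)" .
    moreover have "1 < exp (z e)" using pos[OF e(1)] by simp
    ultimately show ?thesis using iso[OF e(1)] e(2) by (auto simp del: one_less_exp_iff)
  qed
  have inact: "iso_stat M s' P0 e n \<omega> \<le> 1 / A e \<and> iso_stat M s' P0 e n \<omega> < 1"
    if e: "e \<in> units M" "e \<notin> active M P" for e
  proof -
    have "A e = exp (ln (A e))" using thr[OF e(1)] by simp
    also have "\<dots> \<le> exp (z e)" using thr[OF e(1)] e(2) by (subst exp_le_cancel_iff) simp
    finally have "A e \<le> exp (z e)" .
    then have "exp (- z e) \<le> 1 / A e" "exp (- z e) < 1" 
      using thr[OF e(1)] pos[OF e(1)] by (auto simp: exp_minus field_simps)
    then show ?thesis using iso[OF e(1)] e(2) by (auto simp del: exp_less_one_iff)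
  qed
  have "D_iso M s' P0 n \<omega> = active M P"
    using act inact active_subset_units[of M P] unfolding D_iso_def by force
  then have "D_iso M s' P0 n \<omega> \<in> Psi M" using P by (simp add: P_Psi_def)
  moreover have "iso_stat M s' P0 e n \<omega> \<notin> {1 / A e <..< B e}" if "e \<in> units M" for e
    using act[OF that] inact[OF that] by (cases "e \<in> active M P") auto
  ultimately show ?thesis
    unfolding T_star_def using n by (intro Inf_lower) blast
qed

lemma stopping_time_measurable_enat:
  assumes P: "on_paths M (all_sources M) P" and T: "stopping_time (filt M) T"
  shows "T \<in> measurable P (count_space UNIV)"
proof -
  interpret filtration "space (path_space M (all_sources M))" "filt M" by (rule filtration_filt)
  have "T \<in> borel_measurable P"
  proof (rule measurable_stopping_time[OF T])
    fix t show "sets (filt M t) \<subseteq> sets P"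
      using sets_F_mono[of t \<infinity>] on_pathsD(2)[OF P] by (simp add: filt_def)
    show "space (filt M t) = space P" using space_F on_pathsD(3)[OF P] by simp
  qed
  then show ?thesis
    by (subst measurable_count_space_eq2_countable) (auto intro!: measurable_sets)
qed

text \<open>
  The expectation is the sum of the tail probabilities; the first \<open>N\<close> of them are bounded by \<open>1\<close>.
\<close>

lemma expected_time_le:
  assumes P: "prob_space P" and T: "T \<in> measurable P (count_space UNIV)"
    and q: "summable q" "\<And>t. 0 \<le> q t"
    and tail: "\<And>t. N \<le> t \<Longrightarrow> measure P {\<omega> \<in> space P. enat t < T \<omega>} \<le> q t"
  shows "expected_time P T \<le> ennreal (real N + suminf q)"
proof -
  interpret prob_space P by fact
  have "expected_time P T = (\<Sum>t. emeasure P {\<omega> \<in> space P. enat t < T \<omega>})"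
    unfolding expected_time_def by (rule nn_integral_enat_function[OF T])
  also have "\<dots> \<le> (\<Sum>t. ennreal ((if t < N then 1 else 0) + q t))"
  proof (intro suminf_le summableI)
    fix t show "emeasure P {\<omega> \<in> space P. enat t < T \<omega>} \<le> ennreal ((if t < N then 1 else 0) + q t)"
      unfolding emeasure_eq_measure
      using tail[of t] q(2)[of t] prob_le_1 by (intro ennreal_leI) (auto intro: order_trans add_increasing2)
  qed
  also have "\<dots> = ennreal (real N + suminf q)"
  proof -
    have 1: "(\<lambda>t. if t < N then 1 else 0 :: real) sums real N"
      using sums_If_finite_set[of "{..<N}" "\<lambda>_. 1::real"] by simp
    have "(\<lambda>t. (if t < N then 1 else 0) + q t) sums (real N + suminf q)"
      by (intro sums_add 1 summable_sums q)
    then show ?thesis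
      using q(2) by (subst suminf_ennreal2) (auto simp: sums_iff)
  qed
  finally show ?thesis .
qed

text \<open>
  Complete convergence makes \<open>P(Z\<^sub>n < n \<rho>)\<close> summable for each of the finitely many pairs of a unit and
  a rival. From time \<open>N\<close> on, where each \<open>n \<rho>\<close> is at least the corresponding log-threshold, these probabilities bound the tail
  of the stopping time. Hence the overshoot \<open>C\<close> beyond \<open>N\<close> does not depend on the thresholds.
\<close>

lemma expected_T_star_le:
  assumes M: "valid_problem M" "standing_ac M" "{} \<notin> Psi M" "positive_info M I" "condition_CC M I"
    and P: "P \<in> P_Psi M" and s: "\<forall>e\<in>units M. e \<subseteq> s' e \<and> s' e \<subseteq> all_sources M"
    and ne: "\<forall>e\<in>units M. G_Psi M e \<noteq> {} \<and> H_Psi M e \<noteq> {}"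
    and P0: "\<forall>e\<in>units M. P0 e \<in> law M (s' e) ` H_zero M"
    and \<rho>: "\<forall>e\<in>units M. 0 < \<rho> e \<and> \<rho> e < info_min M I (s' e) P (rivals M P e)"
  shows "\<exists>C. \<forall>A B N. (\<forall>e\<in>units M. 0 < A e \<and> 0 < B e) \<and> 1 \<le> N \<and>
     (\<forall>e\<in>units M. ln (if e \<in> active M P then B e else A e) \<le> real N * \<rho> e) \<and>
     stopping_time (filt M) (T_star M s' P0 A B) \<longrightarrow>
     expected_time P (T_star M s' P0 A B) \<le> ennreal (real N + C)"
proof -
  have onP: "on_paths M (all_sources M) P" 
    using P on_paths_dists[OF M(1)] by (auto simp: P_Psi_def)
  interpret P: prob_space P using on_pathsD(1)[OF onP] .
  define bad where "bad n e Q = {\<omega> \<in> space P. LLR M (s' e) n P Q \<omega> < real n * \<rho> e}" for n e Q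
  define q where "q n = (\<Sum>e\<in>units M. \<Sum>Q\<in>rivals M P e. measure P (bad n e Q))" for n
  have bad: "bad n e Q \<in> sets P" if "e \<in> units M" "Q \<in> rivals M P e" for n e Q
  proof -
    have "on_paths M (all_sources M) Q"
      using that rivals_subset P_Psi_subset_dists by (intro on_paths_dists[OF M(1)]) blast
    then have [measurable]: "LLR M (s' e) n P Q \<in> borel_measurable P"
      using that(1) s by (intro measurable_LLR onP) auto
    show ?thesis unfolding bad_def by measurable
  qed
  have "summable (\<lambda>n. measure P (bad n e Q))" if e: "e \<in> units M" and Q: "Q \<in> rivals M P e" for e Q
  proof -
    have se: "e \<subseteq> s' e" "s' e \<subseteq> all_sources M" using s e by auto
    have cmp: "comparable M (s' e) P Q \<or> comparable M (s' e) Q P"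
      by (rule rival_comparable[OF M(1,3) P Q e se])
    then have "complete_growth M I (s' e) P Q" using M(5) by (auto simp: condition_CC_def)
    moreover have "\<rho> e < I (law M (s' e) P) (law M (s' e) Q)"
      using \<rho> e info_min_le[OF finite_rivals[OF M(1)] Q cmp, of I] by force
    ultimately have "summable (\<lambda>n. measure P (bad (Suc n) e Q))"
      by (auto simp: complete_growth_def bad_def)
    then show ?thesis by (rule iffD1[OF summable_Suc_iff])
  qed
  then have q: "summable q" unfolding q_def by (intro summable_sum) auto
  have q0: "0 \<le> q t" for t by (auto simp: q_def intro!: sum_nonneg)
  have "expected_time P (T_star M s' P0 A B) \<le> ennreal (real N + suminf q)"
    if AB: "\<forall>e\<in>units M. 0 < A e \<and> 0 < B e" and N: "1 \<le> N"
      and thr: "\<forall>e\<in>units M. ln (if e \<in> active M P then B e else A e) \<le> real N * \<rho> e"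
      and T: "stopping_time (filt M) (T_star M s' P0 A B)" for A B N
  proof (rule expected_time_le[OF P.prob_space_axioms stopping_time_measurable_enat[OF onP T] q q0])
    fix t assume t: "N \<le> t"
    let ?bad = "\<Union>e\<in>units M. \<Union>Q\<in>rivals M P e. bad t e Q"
    have iso: "AE \<omega> in P. \<forall>e\<in>units M. \<forall>z. (\<forall>Q\<in>rivals M P e. z \<le> LLR M (s' e) t P Q \<omega>) \<longrightarrow>
      (if e \<in> active M P then exp z \<le> iso_stat M s' P0 e t \<omega> else iso_stat M s' P0 e t \<omega> \<le> exp (- z))"
      using s ne P0 N t by (intro AE_finite_allI finite_units M AE_iso_stat_bound P) auto
    have "AE \<omega> in P. \<omega> \<in> {\<omega> \<in> space P. enat t < T_star M s' P0 A B \<omega>} \<longrightarrow> \<omega> \<in> ?bad"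
      using iso
    proof eventually_elim
      case (elim \<omega>)
      show ?case
      proof (rule impI, rule ccontr)
        assume \<omega>: "\<omega> \<in> {\<omega> \<in> space P. enat t < T_star M s' P0 A B \<omega>}" "\<omega> \<notin> ?bad"
        have good: "real t * \<rho> e \<le> LLR M (s' e) t P Q \<omega>" if "e \<in> units M" "Q \<in> rivals M P e" for e Q
          using \<omega> that by (force simp: bad_def)
        have "T_star M s' P0 A B \<omega> \<le> enat t"
        proof (rule T_star_le[OF P, where z = "\<lambda>e. real t * \<rho> e"])
          show "1 \<le> t" using N t by simp
          fix e assume e: "e \<in> units M"
          show "0 < real t * \<rho> e" using e \<rho> N t by auto
          have "real N * \<rho> e \<le> real t * \<rho> e" using e \<rho> t by (intro mult_right_mono) auto
          then show "0 < A e \<and> 0 < B e \<and> ln (if e \<in> active M P then B e else A e) \<le> real t * \<rho> e"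
            using AB thr e by fastforce
          show "if e \<in> active M P then exp (real t * \<rho> e) \<le> iso_stat M s' P0 e t \<omega>
                else iso_stat M s' P0 e t \<omega> \<le> exp (- (real t * \<rho> e))"
            using elim e good[OF e] by blast
        qed
        then show False using \<omega>(1) by (simp add: not_less[symmetric])
      qed
    qed
    then have "measure P {\<omega> \<in> space P. enat t < T_star M s' P0 A B \<omega>} \<le> measure P ?bad"
      using bad finite_units[OF M(1)] finite_rivals[OF M(1)]
      by (intro P.finite_measure_mono_AE sets.finite_UN) auto
    also have "\<dots> \<le> (\<Sum>e\<in>units M. measure P (\<Union>Q\<in>rivals M P e. bad t e Q))"
      using bad finite_units[OF M(1)] finite_rivals[OF M(1)]
      by (intro measure_UNION_le sets.finite_UN) auto
    also have "\<dots> \<le> q t"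
      unfolding q_def using bad finite_rivals[OF M(1)]
      by (intro sum_mono measure_UNION_le) auto
    finally show "measure P {\<omega> \<in> space P. enat t < T_star M s' P0 A B \<omega>} \<le> q t" .
  qed
  then show ?thesis by (intro exI[of _ "suminf q"]) blast
qed

section \<open>First-order asymptotics\<close>

lemma sim_iff:
  "sim f g \<longleftrightarrow> ((\<lambda>p. f (fst p) (snd p) / g (fst p) (snd p)) \<longlongrightarrow> 1) errors_to_0"
  by (simp add: sim_def case_prod_unfold)

lemma sim_cong:
  assumes "\<forall>\<^sub>F p in errors_to_0. f (fst p) (snd p) = f' (fst p) (snd p)"
    and "\<forall>\<^sub>F p in errors_to_0. g (fst p) (snd p) = g' (fst p) (snd p)"
  shows "sim f g \<longleftrightarrow> sim f' g'"
  unfolding sim_iff using assms by (intro tendsto_cong) (auto elim: eventually_elim2)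

text \<open>
  Both quotients are handled through one real-valued ratio that tends to \<open>1\<close>: the bounds force \<open>f\<close> to be
  finite and positive near the limit, where division of extended numbers is ordinary division.
\<close>

lemma sim_sandwich:
  fixes f :: "real \<Rightarrow> real \<Rightarrow> ennreal" and g :: "real \<Rightarrow> real \<Rightarrow> real"
  assumes g: "\<forall>\<^sub>F p in errors_to_0. 0 < g (fst p) (snd p)"
    and lower: "\<And>\<epsilon>. 0 < \<epsilon> \<Longrightarrow> \<epsilon> < 1 \<Longrightarrow>
      \<forall>\<^sub>F p in errors_to_0. ennreal ((1 - \<epsilon>) * g (fst p) (snd p)) \<le> f (fst p) (snd p)"
    and upper: "\<And>\<epsilon>. 0 < \<epsilon> \<Longrightarrow> \<epsilon> < 1 \<Longrightarrow>
      \<forall>\<^sub>F p in errors_to_0. f (fst p) (snd p) \<le> ennreal ((1 + \<epsilon>) * g (fst p) (snd p))"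
  shows "sim f (\<lambda>\<gamma> \<delta>. ennreal (g \<gamma> \<delta>))" "sim (\<lambda>\<gamma> \<delta>. ennreal (g \<gamma> \<delta>)) f"
proof -
  define r where "r p = enn2real (f (fst p) (snd p)) / g (fst p) (snd p)" for p
  have r: "(r \<longlongrightarrow> 1) errors_to_0"
  proof (rule tendstoI)
    fix e :: real assume e: "0 < e"
    define \<epsilon> where "\<epsilon> = min (e / 2) (1 / 2)"
    have \<epsilon>: "0 < \<epsilon>" "\<epsilon> < 1" "\<epsilon> < e" using e by (auto simp: \<epsilon>_def min_def)
    from g lower[OF \<epsilon>(1,2)] upper[OF \<epsilon>(1,2)]
    show "\<forall>\<^sub>F p in errors_to_0. dist (r p) 1 < e"
    proof eventually_elim
      case (elim p)
      let ?f = "f (fst p) (snd p)" and ?g = "g (fst p) (snd p)"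
      have "?f < \<top>" using elim(3) by (auto simp: le_less_trans)
      then obtain x where x: "?f = ennreal x" "0 \<le> x" by (cases ?f) auto
      have "(1 - \<epsilon>) * ?g \<le> x" "x \<le> (1 + \<epsilon>) * ?g"
        using elim x \<epsilon> by (auto simp: ennreal_le_iff)
      then have "1 - \<epsilon> \<le> r p" "r p \<le> 1 + \<epsilon>"
        using elim(1) x by (auto simp: r_def pos_le_divide_eq pos_divide_le_eq)
      then show ?case using \<epsilon> by (auto simp: dist_real_def)
    qed
  qed
  have half: "(0::real) < 1 / 2" "1 / 2 < (1::real)" by auto
  have pos: "\<forall>\<^sub>F p in errors_to_0. 0 < g (fst p) (snd p) \<and>
      (\<exists>x>0. f (fst p) (snd p) = ennreal x)"
    using g lower[OF half] upper[OF half]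
  proof eventually_elim
    case (elim p)
    let ?f = "f (fst p) (snd p)" and ?g = "g (fst p) (snd p)"
    have "?f < \<top>" using elim(3) by (auto simp: le_less_trans)
    then obtain x where x: "?f = ennreal x" "0 \<le> x" by (cases ?f) auto
    have "(1 - 1/2) * ?g \<le> x" using elim(2) x by (simp add: ennreal_le_iff)
    then have "0 < x" using elim(1) by simp
    then show ?case using elim(1) x by blast
  qed
  have "((\<lambda>p. ennreal (r p)) \<longlongrightarrow> ennreal 1) errors_to_0"
    using r by (rule tendsto_ennrealI)
  moreover have "\<forall>\<^sub>F p in errors_to_0. ennreal (r p) = f (fst p) (snd p) / ennreal (g (fst p) (snd p))"
    using pos by eventually_elim (auto simp: r_def divide_ennreal)
  ultimately show "sim f (\<lambda>\<gamma> \<delta>. ennreal (g \<gamma> \<delta>))"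
    unfolding sim_iff ennreal_1 by (rule Lim_transform_eventually)
  have "((\<lambda>p. ennreal (inverse (r p))) \<longlongrightarrow> ennreal (inverse 1)) errors_to_0"
    using r by (intro tendsto_ennrealI tendsto_inverse) auto
  moreover have "\<forall>\<^sub>F p in errors_to_0. ennreal (inverse (r p)) = ennreal (g (fst p) (snd p)) / f (fst p) (snd p)"
    using pos by eventually_elim (auto simp: r_def divide_ennreal)
  ultimately show "sim (\<lambda>\<gamma> \<delta>. ennreal (g \<gamma> \<delta>)) f"
    unfolding sim_iff inverse_1 ennreal_1 by (rule Lim_transform_eventually)
qed

lemma rivals_nonempty:
  assumes "G_Psi M e \<noteq> {}" "H_Psi M e \<noteq> {}" shows "rivals M P e \<noteq> {}"
  using assms by (simp add: rivals_def)

lemma rival_info_min_attained: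
  assumes M: "valid_problem M" "{} \<notin> Psi M" and P: "P \<in> P_Psi M"
    and e: "e \<in> units M" "e \<subseteq> s" "s \<subseteq> all_sources M" "rivals M P e \<noteq> {}"
  obtains Q where "Q \<in> rivals M P e" "comparable M s P Q \<or> comparable M s Q P"
    "info_min M I s P (rivals M P e) = I (law M s P) (law M s Q)"
proof -
  obtain Q0 where "Q0 \<in> rivals M P e" using e(4) by blast
  then show ?thesis
    using info_min_attained[OF finite_rivals[OF M(1)] _ rival_comparable[OF M P _ e(1-3)]] that
    by metis
qed

lemma rival_info_min_pos:
  assumes "valid_problem M" "{} \<notin> Psi M" "P \<in> P_Psi M"
    and "e \<in> units M" "e \<subseteq> s" "s \<subseteq> all_sources M" "rivals M P e \<noteq> {}" and I: "positive_info M I"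
  shows "0 < info_min M I s P (rivals M P e)"
  using rival_info_min_attained[OF assms(1-7), of I] I unfolding positive_info_def by metis

lemma time_bound_ge:
  assumes "valid_problem M" "e \<in> units M"
  shows "\<bar>ln (error_level M P e \<gamma> \<delta>)\<bar> / info_min M I (all_sources M) P (rivals M P e) \<le> time_bound M I P \<gamma> \<delta>"
  unfolding time_bound_rivals using assms finite_units by (intro Max_ge) auto

lemma time_bound_attained:
  assumes "valid_problem M" "{} \<notin> Psi M" "P \<in> P_Psi M"
  obtains e where "e \<in> units M"
    "time_bound M I P \<gamma> \<delta> = \<bar>ln (error_level M P e \<gamma> \<delta>)\<bar> / info_min M I (all_sources M) P (rivals M P e)"
proof -
  let ?f = "\<lambda>e. \<bar>ln (error_level M P e \<gamma> \<delta>)\<bar> / info_min M I (all_sources M) P (rivals M P e)"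
  have "active M P \<noteq> {}" using assms(2,3) by (auto simp: P_Psi_def)
  then have "Max (?f ` units M) \<in> ?f ` units M"
    using active_subset_units[of M P] finite_units[OF assms(1)] by (intro Max_in) auto
  then show ?thesis using that unfolding time_bound_rivals by blast
qed

lemma time_bound_at_top:
  assumes M: "valid_problem M" "{} \<notin> Psi M" "positive_info M I" and P: "P \<in> P_Psi M"
    and ne: "\<forall>e\<in>units M. G_Psi M e \<noteq> {} \<and> H_Psi M e \<noteq> {}"
  shows "filterlim (\<lambda>p. time_bound M I P (fst p) (snd p)) at_top errors_to_0"
proof -
  obtain e where e: "e \<in> units M" using time_bound_attained[OF M(1,2) P] by blast
  then have "e \<subseteq> all_sources M" using M(1) by (auto simp: valid_problem_def)
  then have pos: "0 < info_min M I (all_sources M) P (rivals M P e)"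
    using M P e ne by (intro rival_info_min_pos rivals_nonempty) auto
  have "filterlim (\<lambda>p. \<bar>ln (error_level M P e (fst p) (snd p))\<bar> *
      inverse (info_min M I (all_sources M) P (rivals M P e))) at_top errors_to_0"
    using pos by (intro filterlim_at_top_mult_tendsto_pos[OF tendsto_const]
        filterlim_compose[OF filterlim_abs_ln_at_right_0 filterlim_error_level]) auto
  then show ?thesis
    by (rule filterlim_at_top_mono)
      (auto simp flip: divide_inverse intro!: always_eventually time_bound_ge M(1) e)
qed

text \<open>
  The maximum that defines the time bound is attained at some unit, and the information minimum of
  that unit at some rival. The unit may vary with \<open>\<gamma>\<close> and \<open>\<delta>\<close>, but there are finitely many, so the bounds
  for one hardest rival of each unit hold simultaneously near the limit.
\<close>

lemma tests_lower_bound: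
  assumes M: "valid_problem M" "standing_ac M" "{} \<notin> Psi M" "positive_info M I" "condition_M M I"
    and P: "P \<in> P_Psi M" and ne: "\<forall>e\<in>units M. G_Psi M e \<noteq> {} \<and> H_Psi M e \<noteq> {}"
    and \<eta>: "0 < \<eta>" "\<eta> < 1"
  shows "\<forall>\<^sub>F p in errors_to_0. \<forall>(T, D) \<in> tests M (fst p) (snd p).
    ennreal ((1 - \<eta>) * time_bound M I P (fst p) (snd p)) \<le> expected_time P T"
proof -
  let ?S = "all_sources M"
  let ?i = "\<lambda>e. info_min M I ?S P (rivals M P e)"
  have eS: "e \<subseteq> ?S" if "e \<in> units M" for e using M(1) that by (auto simp: valid_problem_def)
  have rne: "rivals M P e \<noteq> {}" if "e \<in> units M" for e using ne that rivals_nonempty by blast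
  have "\<forall>\<^sub>F p in errors_to_0. \<forall>(T, D) \<in> tests M (fst p) (snd p).
    ennreal ((1 - 2 * (\<eta> / 4))\<^sup>2 * (\<bar>ln (error_level M P e (fst p) (snd p))\<bar> / ?i e)) \<le> expected_time P T"
    if e: "e \<in> units M" for e
  proof -
    obtain Q where Q: "Q \<in> rivals M P e" "?i e = I (law M ?S P) (law M ?S Q)"
      using rival_info_min_attained[OF M(1,3) P e eS[OF e] order_refl rne[OF e], of I] by blast
    show ?thesis
      unfolding Q(2) using \<eta> by (intro tests_lower_bound_rival[OF M P e Q(1)]) auto
  qed
  then have "\<forall>\<^sub>F p in errors_to_0. \<forall>e\<in>units M. \<forall>(T, D) \<in> tests M (fst p) (snd p).
    ennreal ((1 - 2 * (\<eta> / 4))\<^sup>2 * (\<bar>ln (error_level M P e (fst p) (snd p))\<bar> / ?i e)) \<le> expected_time P T"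
    using finite_units[OF M(1)] by (intro eventually_ball_finite) auto
  then show ?thesis
  proof eventually_elim
    case (elim p)
    obtain e where e: "e \<in> units M" "time_bound M I P (fst p) (snd p) =
        \<bar>ln (error_level M P e (fst p) (snd p))\<bar> / ?i e"
      using time_bound_attained[OF M(1,3) P] by blast
    have "0 < ?i e" by (rule rival_info_min_pos[OF M(1,3) P e(1) eS[OF e(1)] order_refl rne[OF e(1)] M(4)])
    moreover have "1 - \<eta> \<le> (1 - 2 * (\<eta> / 4))\<^sup>2"
      by (simp add: power2_eq_square algebra_simps)
    ultimately have "(1 - \<eta>) * time_bound M I P (fst p) (snd p)
        \<le> (1 - 2 * (\<eta> / 4))\<^sup>2 * (\<bar>ln (error_level M P e (fst p) (snd p))\<bar> / ?i e)"
      unfolding e(2) by (intro mult_right_mono) auto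
    then have "ennreal ((1 - \<eta>) * time_bound M I P (fst p) (snd p))
        \<le> ennreal ((1 - 2 * (\<eta> / 4))\<^sup>2 * (\<bar>ln (error_level M P e (fst p) (snd p))\<bar> / ?i e))"
      by (rule ennreal_leI)
    with elim e(1) show ?case by (fastforce intro: order_trans)
  qed
qed

text \<open>
  All active units share the level \<open>\<gamma>\<close>, and all inactive ones share \<open>\<delta>\<close>. Within each of the two groups
  only the smallest information number matters, and by the choice of the isolation subsystems that one
  is as large as with all sources.
\<close>

lemma isolation_time_le:
  assumes M: "valid_problem M" "{} \<notin> Psi M" "positive_info M I" and P: "P \<in> P_Psi M"
    and s: "\<forall>e\<in>units M. e \<subseteq> s' e \<and> s' e \<subseteq> all_sources M"
    and ne: "\<forall>e\<in>units M. G_Psi M e \<noteq> {} \<and> H_Psi M e \<noteq> {}"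
    and sel: "isolation_selected M I s' P" and e: "e \<in> units M"
  shows "\<bar>ln (error_level M P e \<gamma> \<delta>)\<bar> / info_min M I (s' e) P (rivals M P e) \<le> time_bound M I P \<gamma> \<delta>"
proof -
  let ?S = "all_sources M"
  define F where "F = (if e \<in> active M P then active M P else units M - active M P)"
  have F: "finite F" "e \<in> F" "F \<subseteq> units M"
    using e active_subset_units[of M P] finite_units[OF M(1)] by (auto simp: F_def intro: finite_subset)
  have same: "f \<in> active M P \<longleftrightarrow> e \<in> active M P" if "f \<in> F" for f
    using that by (auto simp: F_def split: if_splits)
  then have riv: "rivals M P f = (if e \<in> active M P then H_Psi M f else G_Psi M f)" if "f \<in> F" for f
    using that by (simp add: rivals_def)
  have "Min ((\<lambda>f. info_min M I (s' f) P (rivals M P f)) ` F) = Min ((\<lambda>f. info_min M I ?S P (rivals M P f)) ` F)"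
  proof (cases "e \<in> active M P")
    case True
    then have "(\<lambda>f. info_min M I (t f) P (rivals M P f)) ` F = (\<lambda>f. info_min M I (t f) P (H_Psi M f)) ` active M P" for t
      using riv by (intro image_cong) (auto simp: F_def)
    then show ?thesis using sel by (simp add: isolation_selected_def)
  next
    case False
    then have "(\<lambda>f. info_min M I (t f) P (rivals M P f)) ` F = (\<lambda>f. info_min M I (t f) P (G_Psi M f)) ` (units M - active M P)" for t
      using riv by (intro image_cong) (auto simp: F_def)
    then show ?thesis using sel by (simp add: isolation_selected_def)
  qed
  moreover have "Min ((\<lambda>f. info_min M I ?S P (rivals M P f)) ` F) \<in> (\<lambda>f. info_min M I ?S P (rivals M P f)) ` F"
    using F by (intro Min_in) auto
  moreover have "Min ((\<lambda>f. info_min M I (s' f) P (rivals M P f)) ` F) \<le> info_min M I (s' e) P (rivals M P e)"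
    using F by (intro Min_le) auto
  ultimately obtain f where f: "f \<in> F" "info_min M I ?S P (rivals M P f) \<le> info_min M I (s' e) P (rivals M P e)"
    by auto
  have fu: "f \<in> units M" using f F by auto
  then have "0 < info_min M I ?S P (rivals M P f)"
    using M P ne by (intro rival_info_min_pos rivals_nonempty) (auto simp: valid_problem_def)
  then have "\<bar>ln (error_level M P e \<gamma> \<delta>)\<bar> / info_min M I (s' e) P (rivals M P e)
      \<le> \<bar>ln (error_level M P f \<gamma> \<delta>)\<bar> / info_min M I ?S P (rivals M P f)"
    using f same[OF f(1)] by (auto simp: error_level_def intro!: divide_left_mono)
  also have "\<dots> \<le> time_bound M I P \<gamma> \<delta>" by (rule time_bound_ge[OF M(1) fu])
  finally show ?thesis .
qed

lemma sim_ln_threshold: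
  fixes a l :: "real \<Rightarrow> real \<Rightarrow> real" and \<epsilon> :: real
  assumes "sim (\<lambda>\<gamma> \<delta>. ln (a \<gamma> \<delta>)) (\<lambda>\<gamma> \<delta>. \<bar>ln (l \<gamma> \<delta>)\<bar>)" 
    and l: "\<forall>\<^sub>F p in errors_to_0. l (fst p) (snd p) \<in> {0<..<1}" and "0 < \<epsilon>"
  shows "\<forall>\<^sub>F p in errors_to_0. ln (a (fst p) (snd p)) \<le> (1 + \<epsilon>) * \<bar>ln (l (fst p) (snd p))\<bar>"
proof -
  have "\<forall>\<^sub>F p in errors_to_0. ln (a (fst p) (snd p)) / \<bar>ln (l (fst p) (snd p))\<bar> < 1 + \<epsilon>"
    using assms(1,3) unfolding sim_iff by (intro order_tendstoD(2)) auto
  with l show ?thesis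
  proof eventually_elim
    case (elim p)
    then have "0 < \<bar>ln (l (fst p) (snd p))\<bar>" by auto
    then show ?case using elim(2) by (simp add: pos_divide_less_eq)
  qed
qed

text \<open>
  The waiting time for unit \<open>e\<close> at a rate slightly below its information number is at most
  \<open>(1 + \<epsilon>) / (1 - \<epsilon>)\<close> times the time bound, up to rounding; the bounded overshoot is negligible because
  the time bound tends to infinity.
\<close>

lemma T_star_upper_bound:
  assumes M: "valid_problem M" "standing_ac M" "{} \<notin> Psi M" "positive_info M I" "condition_CC M I"
    and P: "P \<in> P_Psi M" and s: "\<forall>e\<in>units M. e \<subseteq> s' e \<and> s' e \<subseteq> all_sources M"
    and ne: "\<forall>e\<in>units M. G_Psi M e \<noteq> {} \<and> H_Psi M e \<noteq> {}"
    and P0: "\<forall>e\<in>units M. P0 e \<in> law M (s' e) ` H_zero M"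
    and sel: "isolation_selected M I s' P"
    and AB: "\<forall>e\<in>units M. \<forall>\<gamma>\<in>{0<..<1}. \<forall>\<delta>\<in>{0<..<1}. A e \<gamma> \<delta> > 0 \<and> B e \<gamma> \<delta> > 0"
    and T: "\<forall>\<gamma>\<in>{0<..<1}. \<forall>\<delta>\<in>{0<..<1}.
           stopping_time (filt M) (T_star M s' P0 (\<lambda>e. A e \<gamma> \<delta>) (\<lambda>e. B e \<gamma> \<delta>))"
    and A: "\<forall>e\<in>units M. sim (\<lambda>\<gamma> \<delta>. ln (A e \<gamma> \<delta>)) (\<lambda>\<gamma> \<delta>. \<bar>ln \<delta>\<bar>)"
    and B: "\<forall>e\<in>units M. sim (\<lambda>\<gamma> \<delta>. ln (B e \<gamma> \<delta>)) (\<lambda>\<gamma> \<delta>. \<bar>ln \<gamma>\<bar>)"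
    and \<eta>: "0 < \<eta>"
  shows "\<forall>\<^sub>F p in errors_to_0.
    expected_time P (T_star M s' P0 (\<lambda>e. A e (fst p) (snd p)) (\<lambda>e. B e (fst p) (snd p)))
      \<le> ennreal ((1 + \<eta>) * time_bound M I P (fst p) (snd p))"
proof -
  \<comment> \<open>The solution of \<open>(1 + \<epsilon>) / (1 - \<epsilon>) = 1 + \<eta> / 2\<close>; the other half of \<open>\<eta>\<close> absorbs rounding and overshoot.\<close>
  define \<epsilon> where "\<epsilon> = \<eta> / (\<eta> + 4)"
  have \<epsilon>: "0 < \<epsilon>" "\<epsilon> < 1" "1 + \<epsilon> = (1 + \<eta> / 2) * (1 - \<epsilon>)"
    using \<eta> by (auto simp: \<epsilon>_def field_simps)
  define i where "i e = info_min M I (s' e) P (rivals M P e)" for e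
  have i: "0 < i e" if "e \<in> units M" for e
    unfolding i_def using that s ne by (intro rival_info_min_pos rivals_nonempty M P) auto
  define \<rho> where "\<rho> e = (1 - \<epsilon>) * i e" for e
  have "\<forall>e\<in>units M. 0 < \<rho> e \<and> \<rho> e < info_min M I (s' e) P (rivals M P e)"
    using i \<epsilon> by (auto simp: \<rho>_def i_def[symmetric] mult_less_cancel_right1)
  from expected_T_star_le[OF M P s ne P0 this] obtain C where C:
    "\<And>A B N. \<lbrakk>\<forall>e\<in>units M. 0 < A e \<and> 0 < B e; 1 \<le> N;
     \<forall>e\<in>units M. ln (if e \<in> active M P then B e else A e) \<le> real N * \<rho> e;
     stopping_time (filt M) (T_star M s' P0 A B)\<rbrakk> \<Longrightarrow>
     expected_time P (T_star M s' P0 A B) \<le> ennreal (real N + C)" by blast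
  define thr where "thr e \<gamma> \<delta> = (if e \<in> active M P then B e \<gamma> \<delta> else A e \<gamma> \<delta>)" for e \<gamma> \<delta>
  have unit: "\<forall>\<^sub>F p in errors_to_0. fst p \<in> {0<..<1::real} \<and> snd p \<in> {0<..<1::real}"
    by (rule errors_to_0_eventually) simp
  have "\<forall>\<^sub>F p in errors_to_0. ln (thr e (fst p) (snd p)) \<le> (1 + \<epsilon>) * \<bar>ln (error_level M P e (fst p) (snd p))\<bar>"
    if e: "e \<in> units M" for e
  proof (rule sim_ln_threshold[OF _ _ \<epsilon>(1)])
    show "sim (\<lambda>\<gamma> \<delta>. ln (thr e \<gamma> \<delta>)) (\<lambda>\<gamma> \<delta>. \<bar>ln (error_level M P e \<gamma> \<delta>)\<bar>)"
      using A B e by (cases "e \<in> active M P") (auto simp: thr_def error_level_def)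
    show "\<forall>\<^sub>F p in errors_to_0. error_level M P e (fst p) (snd p) \<in> {0<..<1}"
      using unit by eventually_elim (auto simp: error_level_def)
  qed
  then have thr: "\<forall>\<^sub>F p in errors_to_0. \<forall>e\<in>units M.
      ln (thr e (fst p) (snd p)) \<le> (1 + \<epsilon>) * \<bar>ln (error_level M P e (fst p) (snd p))\<bar>"
    using finite_units[OF M(1)] by (intro eventually_ball_finite) auto
  have "\<forall>\<^sub>F p in errors_to_0. max 0 (2 * (2 + C) / \<eta>) \<le> time_bound M I P (fst p) (snd p)"
    using time_bound_at_top[OF M(1,3,4) P ne] unfolding filterlim_at_top by blast
  with unit thr show ?thesis
  proof eventually_elim
    case (elim p)
    let ?b = "time_bound M I P (fst p) (snd p)"
    define N where "N = Suc (nat \<lceil>(1 + \<eta> / 2) * ?b\<rceil>)"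
    have b: "0 \<le> ?b" "2 * (2 + C) / \<eta> \<le> ?b" using elim(3) by auto
    have N: "(1 + \<eta> / 2) * ?b \<le> real N" "real N \<le> (1 + \<eta> / 2) * ?b + 2" "1 \<le> N"
      using b \<eta> mult_nonneg_nonneg[of "1 + \<eta> / 2" ?b] unfolding N_def by linarith+
    have "ln (thr e (fst p) (snd p)) \<le> real N * \<rho> e" if e: "e \<in> units M" for e
    proof -
      let ?l = "\<bar>ln (error_level M P e (fst p) (snd p))\<bar>"
      have "ln (thr e (fst p) (snd p)) \<le> (1 + \<epsilon>) * ?l" using elim(2) e by blast
      also have "\<dots> = (1 + \<eta> / 2) * (?l / i e) * \<rho> e"
        using i[OF e] \<epsilon> by (simp add: \<rho>_def)
      also have "\<dots> \<le> (1 + \<eta> / 2) * ?b * \<rho> e"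
        using i[OF e] \<epsilon> \<eta> isolation_time_le[OF M(1,3,4) P s ne sel e, of "fst p" "snd p"]
        by (intro mult_right_mono mult_left_mono) (auto simp: \<rho>_def i_def)
      also have "\<dots> \<le> real N * \<rho> e"
        using N i[OF e] \<epsilon> by (intro mult_right_mono) (auto simp: \<rho>_def)
      finally show ?thesis .
    qed
    then have "expected_time P (T_star M s' P0 (\<lambda>e. A e (fst p) (snd p)) (\<lambda>e. B e (fst p) (snd p)))
        \<le> ennreal (real N + C)"
      using AB T elim(1) N by (intro C) (auto simp: thr_def)
    also have "real N + C \<le> (1 + \<eta>) * ?b"
    proof -
      have "2 + C \<le> \<eta> / 2 * ?b" using b(2) \<eta> by (simp add: field_simps)
      then show ?thesis using N(2) by (simp add: algebra_simps)
    qed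
    finally show ?case by (simp add: ennreal_leI)
  qed
qed

section \<open>A known number of active units\<close>

text \<open>
  Two distinct finite sets of equal size differ in both directions. Hence a law in \<open>\<P>\<^sub>\<Psi>\<close> whose active set
  differs from that of \<open>P\<close> is a rival at some active unit and also at some inactive unit. The hardest
  such law therefore attains the information minimum in both groups of units, and the smaller of the
  two error levels decides.
\<close>

lemma time_bound_card:
  assumes M: "valid_problem M" "{} \<notin> Psi M" "positive_info M I" and P: "P \<in> P_Psi M"
    and ne: "\<forall>e\<in>units M. G_Psi M e \<noteq> {} \<and> H_Psi M e \<noteq> {}"
    and m: "Psi M = {D. D \<subseteq> units M \<and> card D = m}"
    and \<gamma>\<delta>: "\<gamma> \<in> {0<..<1}" "\<delta> \<in> {0<..<1}"
  shows "time_bound M I P \<gamma> \<delta> = \<bar>ln (min \<gamma> \<delta>)\<bar> / info_min M I (all_sources M) P (P_Psi M - {P})"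
proof -
  let ?S = "all_sources M"
  let ?f = "\<lambda>e. info_min M I ?S P (rivals M P e)"
  let ?J = "info_min M I ?S P (P_Psi M - {P})"
  have eS: "e \<subseteq> ?S" if "e \<in> units M" for e using M(1) that by (auto simp: valid_problem_def)
  have rne: "rivals M P e \<noteq> {}" if "e \<in> units M" for e using ne that rivals_nonempty by blast
  have fin: "finite (P_Psi M - {P})"
    using finite_dists[OF M(1)] P_Psi_subset_dists by (auto intro: finite_subset)
  have att: "\<exists>Q\<in>rivals M P e. (comparable M ?S P Q \<or> comparable M ?S Q P) \<and> Q \<in> P_Psi M - {P} \<and> 
      ?f e = I (law M ?S P) (law M ?S Q)" if e: "e \<in> units M" for e
  proof -
    obtain Q where Q: "Q \<in> rivals M P e" "comparable M ?S P Q \<or> comparable M ?S Q P"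
      "?f e = I (law M ?S P) (law M ?S Q)"
      using rival_info_min_attained[OF M(1,2) P e eS[OF e] order_refl rne[OF e], of I] by blast
    have "Q \<in> P_Psi M - {P}"
      using Q(1) rivals_subset by (auto simp: rivals_def G_Psi_def H_Psi_def split: if_splits)
    then show ?thesis using Q by blast
  qed
  have le: "?J \<le> ?f e" if "e \<in> units M" for e
    using att[OF that] info_min_le[OF fin] by fastforce
  have "\<exists>e. e \<in> units M"
    using time_bound_attained[OF M(1,2) P] by blast
  then obtain Q0 where "Q0 \<in> P_Psi M - {P}" "comparable M ?S P Q0 \<or> comparable M ?S Q0 P"
    using att by blast
  from info_min_attained[OF fin this] obtain Q where
    Q: "Q \<in> P_Psi M - {P}" "comparable M ?S P Q \<or> comparable M ?S Q P" "?J = I (law M ?S P) (law M ?S Q)"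
    by metis
  have J: "0 < ?J" using Q M(3) by (auto simp: positive_info_def)
  have nz: "P \<notin> H_zero M" "Q \<notin> H_zero M" using P_Psi_not_H_zero[OF M(1,2)] P Q(1) by auto
  then have diff: "active M P \<noteq> active M Q"
    using Q(2) by (auto simp: comparable_def G_Psi_def H_Psi_def)
  have card: "card (active M P) = m" "card (active M Q) = m" "finite (active M P)" "finite (active M Q)"
    using P Q(1) m active_subset_units finite_units[OF M(1)] by (auto simp: P_Psi_def intro: finite_subset)
  obtain e1 where e1: "e1 \<in> active M P" "e1 \<notin> active M Q"
    using card diff by (metis card_subset_eq subsetI)
  obtain e2 where e2: "e2 \<in> active M Q" "e2 \<notin> active M P"
    using card diff by (metis card_subset_eq subsetI)
  have "Q \<in> rivals M P e1" "Q \<in> rivals M P e2"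
    using e1 e2 nz Q(1) by (auto simp: rivals_def G_Psi_def H_Psi_def)
  then have "?f e1 \<le> ?J" "?f e2 \<le> ?J"
    unfolding Q(3) using Q(2) finite_rivals[OF M(1)] by (auto intro: info_min_le)
  then have eq: "?f e1 = ?J" "?f e2 = ?J"
    using le[of e1] le[of e2] e1 e2 active_subset_units by fastforce+
  have lnmin: "\<bar>ln \<gamma>\<bar> \<le> \<bar>ln (min \<gamma> \<delta>)\<bar>" "\<bar>ln \<delta>\<bar> \<le> \<bar>ln (min \<gamma> \<delta>)\<bar>"
    using \<gamma>\<delta> by (auto simp: min_def)
  show ?thesis
    unfolding time_bound_rivals
  proof (rule Max_eqI)
    show "finite ((\<lambda>e. \<bar>ln (error_level M P e \<gamma> \<delta>)\<bar> / ?f e) ` units M)"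
      using finite_units[OF M(1)] by simp
    show "y \<le> \<bar>ln (min \<gamma> \<delta>)\<bar> / ?J" if y: "y \<in> (\<lambda>e. \<bar>ln (error_level M P e \<gamma> \<delta>)\<bar> / ?f e) ` units M" for y
      using y le J lnmin by (auto simp: error_level_def intro!: frac_le)
    show "\<bar>ln (min \<gamma> \<delta>)\<bar> / ?J \<in> (\<lambda>e. \<bar>ln (error_level M P e \<gamma> \<delta>)\<bar> / ?f e) ` units M"
    proof (cases "\<gamma> \<le> \<delta>")
      case True
      then have "\<bar>ln (min \<gamma> \<delta>)\<bar> / ?J = \<bar>ln (error_level M P e1 \<gamma> \<delta>)\<bar> / ?f e1"
        using e1 eq by (simp add: error_level_def)
      then show ?thesis using e1 active_subset_units by blast
    next
      case False
      then have "\<bar>ln (min \<gamma> \<delta>)\<bar> / ?J = \<bar>ln (error_level M P e2 \<gamma> \<delta>)\<bar> / ?f e2"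
        using e2 eq by (simp add: error_level_def)
      then show ?thesis using e2 active_subset_units by blast
    qed
  qed
qed

theorem theorem4p3:
  fixes M :: "'b problem"
    and I :: "'b info"
    and P :: "'b path measure"
    and s' :: "nat set \<Rightarrow> nat set"
    and P0 :: "nat set \<Rightarrow> 'b path measure"
    and A B :: "nat set \<Rightarrow> real \<Rightarrow> real \<Rightarrow> real"
  assumes "valid_problem M"
    and "standing_ac M"
    and "positive_info M I" and "condition_M M I" and "condition_CC M I"
    and "{} \<notin> Psi M"
    and "P \<in> P_Psi M"
    and "\<forall>e\<in>units M. e \<subseteq> s' e \<and> s' e \<subseteq> all_sources M"
    and "\<forall>e\<in>units M. G_Psi M e \<noteq> {} \<and> H_Psi M e \<noteq> {}"
    and "\<forall>e\<in>units M. P0 e \<in> law M (s' e) ` H_zero M"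
    and "isolation_selected M I s' P"
    and "\<forall>e\<in>units M. \<forall>\<gamma>\<in>{0<..<1}. \<forall>\<delta>\<in>{0<..<1}. A e \<gamma> \<delta> > 0 \<and> B e \<gamma> \<delta> > 0"
    and "\<forall>\<gamma>\<in>{0<..<1}. \<forall>\<delta>\<in>{0<..<1}.
           (T_star M s' P0 (\<lambda>e. A e \<gamma> \<delta>) (\<lambda>e. B e \<gamma> \<delta>),
            D_star M s' P0 (\<lambda>e. A e \<gamma> \<delta>) (\<lambda>e. B e \<gamma> \<delta>)) \<in> tests M \<gamma> \<delta>"
    and "\<forall>e\<in>units M. sim (\<lambda>\<gamma> \<delta>. ln (A e \<gamma> \<delta>)) (\<lambda>\<gamma> \<delta>. \<bar>ln \<delta>\<bar>)"
    and "\<forall>e\<in>units M. sim (\<lambda>\<gamma> \<delta>. ln (B e \<gamma> \<delta>)) (\<lambda>\<gamma> \<delta>. \<bar>ln \<gamma>\<bar>)"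
  shows "sim (\<lambda>\<gamma> \<delta>. expected_time P (T_star M s' P0 (\<lambda>e. A e \<gamma> \<delta>) (\<lambda>e. B e \<gamma> \<delta>)))
             (\<lambda>\<gamma> \<delta>. ennreal (time_bound M I P \<gamma> \<delta>)) \<and>
         sim (\<lambda>\<gamma> \<delta>. ennreal (time_bound M I P \<gamma> \<delta>)) (optimal_time M P) \<and>
         (\<forall>m. 0 < m \<and> m < card (units M) \<and> Psi M = {D. D \<subseteq> units M \<and> card D = m} \<longrightarrow>
            sim (\<lambda>\<gamma> \<delta>. expected_time P (T_star M s' P0 (\<lambda>e. A e \<gamma> \<delta>) (\<lambda>e. B e \<gamma> \<delta>)))
                (\<lambda>\<gamma> \<delta>. ennreal (\<bar>ln (min \<gamma> \<delta>)\<bar> /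
                                  info_min M I (all_sources M) P (P_Psi M - {P}))) \<and>
            sim (\<lambda>\<gamma> \<delta>. ennreal (\<bar>ln (min \<gamma> \<delta>)\<bar> /
                                  info_min M I (all_sources M) P (P_Psi M - {P})))
                (optimal_time M P))"
proof -
  define ET where "ET \<gamma> \<delta> = expected_time P (T_star M s' P0 (\<lambda>e. A e \<gamma> \<delta>) (\<lambda>e. B e \<gamma> \<delta>))" for \<gamma> \<delta>
  define tb where "tb = time_bound M I P"
  have unit: "\<forall>\<^sub>F p in errors_to_0. fst p \<in> {0<..<1::real} \<and> snd p \<in> {0<..<1::real}"
    by (rule errors_to_0_eventually) simp
  have tb_pos: "\<forall>\<^sub>F p in errors_to_0. 0 < tb (fst p) (snd p)"
    using time_bound_at_top[OF assms(1,6,3,7,9)] unfolding tb_def filterlim_at_top_dense by blast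
  have opt_le: "\<forall>\<^sub>F p in errors_to_0. optimal_time M P (fst p) (snd p) \<le> ET (fst p) (snd p)"
    using unit
  proof eventually_elim
    case (elim p)
    then have "(T_star M s' P0 (\<lambda>e. A e (fst p) (snd p)) (\<lambda>e. B e (fst p) (snd p)),
        D_star M s' P0 (\<lambda>e. A e (fst p) (snd p)) (\<lambda>e. B e (fst p) (snd p))) \<in> tests M (fst p) (snd p)"
      using assms(13) by blast
    then show ?case
      unfolding optimal_time_def ET_def by (rule INF_lower2) simp
  qed
  have lower: "\<forall>\<^sub>F p in errors_to_0. ennreal ((1 - \<epsilon>) * tb (fst p) (snd p)) \<le> optimal_time M P (fst p) (snd p)"
    if "0 < \<epsilon>" "\<epsilon> < 1" for \<epsilon>
    using tests_lower_bound[OF assms(1,2,6,3,4,7,9) that]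
    by eventually_elim (auto simp: optimal_time_def tb_def intro!: INF_greatest)
  have stop: "\<forall>\<gamma>\<in>{0<..<1}. \<forall>\<delta>\<in>{0<..<1}.
      stopping_time (filt M) (T_star M s' P0 (\<lambda>e. A e \<gamma> \<delta>) (\<lambda>e. B e \<gamma> \<delta>))"
    using assms(13) by (auto simp: tests_def)
  have upper: "\<forall>\<^sub>F p in errors_to_0. ET (fst p) (snd p) \<le> ennreal ((1 + \<epsilon>) * tb (fst p) (snd p))"
    if "0 < \<epsilon>" for \<epsilon>
    unfolding ET_def tb_def
    by (rule T_star_upper_bound[OF assms(1,2,6,3,5,7,8,9,10,11,12) stop assms(14,15) that])
  have ET: "sim ET (\<lambda>\<gamma> \<delta>. ennreal (tb \<gamma> \<delta>))"
  proof (rule sim_sandwich(1)[OF tb_pos _ upper])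
    fix \<epsilon> :: real assume \<epsilon>: "0 < \<epsilon>" "\<epsilon> < 1"
    show "\<forall>\<^sub>F p in errors_to_0. ennreal ((1 - \<epsilon>) * tb (fst p) (snd p)) \<le> ET (fst p) (snd p)"
      using lower[OF \<epsilon>] opt_le by eventually_elim (rule order_trans)
  qed
  have opt: "sim (\<lambda>\<gamma> \<delta>. ennreal (tb \<gamma> \<delta>)) (optimal_time M P)"
  proof (rule sim_sandwich(2)[OF tb_pos lower])
    fix \<epsilon> :: real assume \<epsilon>: "0 < \<epsilon>"
    show "\<forall>\<^sub>F p in errors_to_0. optimal_time M P (fst p) (snd p) \<le> ennreal ((1 + \<epsilon>) * tb (fst p) (snd p))"
      using opt_le upper[OF \<epsilon>] by eventually_elim (rule order_trans)
  qed
  have "sim ET (\<lambda>\<gamma> \<delta>. ennreal (\<bar>ln (min \<gamma> \<delta>)\<bar> / info_min M I (all_sources M) P (P_Psi M - {P}))) \<and>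
    sim (\<lambda>\<gamma> \<delta>. ennreal (\<bar>ln (min \<gamma> \<delta>)\<bar> / info_min M I (all_sources M) P (P_Psi M - {P}))) (optimal_time M P)"
    if m: "Psi M = {D. D \<subseteq> units M \<and> card D = m}" for m
  proof -
    have "\<forall>\<^sub>F p in errors_to_0. ennreal (tb (fst p) (snd p)) =
        ennreal (\<bar>ln (min (fst p) (snd p))\<bar> / info_min M I (all_sources M) P (P_Psi M - {P}))"
      using unit unfolding tb_def
      by eventually_elim (auto simp: time_bound_card[OF assms(1,6,3,7,9) m])
    from sim_cong[OF always_eventually this, of ET ET] sim_cong[OF this always_eventually, of "optimal_time M P" "optimal_time M P"]
    show ?thesis using ET opt by simp
  qed
  with ET opt show ?thesis unfolding ET_def tb_def by blast
qed

end
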